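(* Let $\alpha>0$. For every integer $p\ge 2$ let $\mathfrak{p}_\alpha(t)$, $t>0$, be the on-diagonal heat kernel of the $p$-adic fractional derivative $\mathfrak{D}^\alpha=\mathfrak{D}^\alpha_p$ on $\mathbb{Q}_p$. Then there exists a non-constant, strictly positive, continuous, $\alpha$-periodic function $\mathcal{A}=\mathcal{A}_p:\mathbb{R}\to(0,\infty)$ such that $$\mathfrak{p}_\alpha(t)=t^{-1/\alpha}\,\mathcal{A}(\log_p t)\qquad\text{for all } t>0 .$$ For fixed $\alpha>0$, as $p\to\infty$, $$\min\mathcal{A}_p\sim p^{-1}(\log p)^{1/\alpha}\qquad\text{and}\qquad \max\mathcal{A}_p\to(e\alpha)^{-1/\alpha}.$$ Moreover, for general $c>0$, if $\mathfrak{p}^{(c)}_\alpha(t)$ denotes the on-diagonal heat kernel of the homogeneous hierarchical Laplacian on $\mathbb{Q}_p$ with eigenvalues $\lambda_k=(c/p^k)^\alpha$, $k\in\mathbb{Z}$ (the operator $\mathfrak{D}^\alpha$ being the case $c=p$), then for all $t>0$ $$\mathfrak{p}^{(c)}_\alpha(t)=t^{-1/\alpha}\,\frac{p}{c}\,\mathcal{A}\bigl(\log_p t+\alpha\log_p(c/p)\bigr).$$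
   Context: For an integer $p\ge2$ (not necessarily prime), $\mathbb{Q}_p$ is the ring of $p$-adic numbers: formal series $x=\sum_{n\in\mathbb{Z}}a_np^n$ with $a_n\in\{0,\dots,p-1\}$ and $a_n=0$ for all sufficiently negative $n$, with addition and multiplication with carries. For $x\neq0$, $\|x\|_p=p^{-k}$ where $k$ is the smallest index with $a_k\ne0$; $\|0\|_p=0$. The metric $\|x-y\|_p$ is an ultrametric; $\mathbb{Z}_p=\{x:\|x\|_p\le1\}$; closed balls are $B(x,p^k)=x+p^{-k}\mathbb{Z}_p$, $k\in\mathbb{Z}$. $m$ is the Haar measure of $(\mathbb{Q}_p,+)$ with $m(\mathbb{Z}_p)=1$, so $V(k):=m(B(x,p^k))=p^k$. Given a strictly decreasing sequence $(\lambda_k)_{k\in\mathbb{Z}}$ of positive numbers with $\lambda_k\to0$ as $k\to+\infty$ and $\lambda_k\to\infty$ as $k\to-\infty$, put $C_k=\lambda_k-\lambda_{k+1}$. The homogeneous hierarchical Laplacian with eigenvalues $(\lambda_k)$ is defined on locally constant compactly supported functions $f$ by $$Lf(x)=\sum_{k\in\mathbb{Z}}C_k\Bigl(f(x)-\frac1{m(B(x,p^k))}\int_{B(x,p^k)}f\,dm\Bigr);$$ it is essentially self-adjoint in $\mathcal{L}^2(\mathbb{Q}_p,m)$, and $L$ also denotes its self-adjoint extension. Its heat kernel $\mathfrak{p}(t,x,y)$ is the continuous kernel with respect to $m$ of the semigroup $e^{-tL}$, $t>0$. The on-diagonal heat kernel $\mathfrak{p}(t)=\mathfrak{p}(t,x,x)$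 does not depend on $x$ and is given by $$\mathfrak{p}(t)=\sum_{k\in\mathbb{Z}}e^{-t\lambda_k}\Bigl(\frac1{V(k-1)}-\frac1{V(k)}\Bigr).$$ The operator of $p$-adic fractional derivative $\mathfrak{D}^\alpha$ is the homogeneous hierarchical Laplacian with $\lambda_k=(p/p^k)^\alpha$. Equivalently, it is the hierarchical Laplacian with eigenvalues $\mathsf{diam}(B)^{-\alpha}$ ($B$ a ball) with respect to the metric $d(x,y)=\|x-y\|_p/p$. $\log$ is the natural logarithm, $\log_p$ the logarithm to base $p$, and $\sim$ means that the quotient tends to $1$. *)

theory Defs
  imports "HOL-Analysis.Analysis" "HOL-Library.Landau_Symbols"
begin

section \<open>The additive group of p-adic numbers, for an arbitrary integer base\<close>

text \<open>
  The series with digits \<open>a n\<close> is represented by its digit function. The base \<open>p\<close> has to vary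
  inside statements, so the p-adic numbers form a carrier set and not a type. Only
  addition, subtraction and the norm enter the theory of hierarchical Laplacians, so
  multiplication is not introduced.
\<close>

definition Qp :: "nat \<Rightarrow> (int \<Rightarrow> nat) set" where
  "Qp p = {a. (\<forall>n. a n < p) \<and> (\<exists>N. \<forall>n<N. a n = 0)}"

text \<open>
  \<open>carry p s n\<close> is the carry entering position \<open>n\<close> when the formal series with coefficients
  \<open>s n\<close> (zero for all sufficiently negative \<open>n\<close>) is brought into digit form.
\<close>

definition carry :: "nat \<Rightarrow> (int \<Rightarrow> nat) \<Rightarrow> int \<Rightarrow> nat" where
  "carry p s = (THE c. (\<exists>N. \<forall>n<N. c n = 0) \<and> (\<forall>n. c (n + 1) = (s n + c n) div p))"

definition padd :: "nat \<Rightarrow> (int \<Rightarrow> nat) \<Rightarrow> (int \<Rightarrow> nat) \<Rightarrow> int \<Rightarrow> nat" where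
  "padd p x y = (\<lambda>n. (x n + y n + carry p (\<lambda>i. x i + y i) n) mod p)"

definition pdiff :: "nat \<Rightarrow> (int \<Rightarrow> nat) \<Rightarrow> (int \<Rightarrow> nat) \<Rightarrow> int \<Rightarrow> nat" where
  "pdiff p x y = (THE z. z \<in> Qp p \<and> padd p y z = x)"

definition pnorm :: "nat \<Rightarrow> (int \<Rightarrow> nat) \<Rightarrow> real" where
  "pnorm p x = (if x = (\<lambda>_. 0) then 0 else real p powi (- (LEAST k. x k \<noteq> 0)))"

text \<open>
  The value 0 off the carrier is needed because the locale \<open>Metric_space\<close> demands symmetry and
  non-negativity on the whole type.
\<close>

definition pdist :: "nat \<Rightarrow> (int \<Rightarrow> nat) \<Rightarrow> (int \<Rightarrow> nat) \<Rightarrow> real" where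
  "pdist p x y = (if x \<in> Qp p \<and> y \<in> Qp p then pnorm p (pdiff p x y) else 0)"

definition Qp_top :: "nat \<Rightarrow> (int \<Rightarrow> nat) topology" where
  "Qp_top p = Metric_space.mtopology (Qp p) (pdist p)"

text \<open>\<open>pball p x k\<close> is the closed ball with centre \<open>x\<close> and radius \<open>p\<close> to the power \<open>k\<close>.\<close>

definition pball :: "nat \<Rightarrow> (int \<Rightarrow> nat) \<Rightarrow> int \<Rightarrow> (int \<Rightarrow> nat) set" where
  "pball p x k = Metric_space.mcball (Qp p) (pdist p) x (real p powi k)"

definition Zp :: "nat \<Rightarrow> (int \<Rightarrow> nat) set" where
  "Zp p = {x \<in> Qp p. pnorm p x \<le> 1}"

text \<open>
  The normalised Haar measure. Since the open set \<open>Zp p\<close> has measure 1, translation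
  invariance already makes the measure finite on compact sets.
\<close>

definition haar_measure :: "nat \<Rightarrow> (int \<Rightarrow> nat) measure \<Rightarrow> bool" where
  "haar_measure p M \<longleftrightarrow>
     space M = Qp p \<and>
     sets M = sigma_sets (Qp p) {U. openin (Qp_top p) U} \<and>
     (\<forall>a\<in>Qp p. \<forall>A\<in>sets M. emeasure M (padd p a ` A) = emeasure M A) \<and>
     emeasure M (Zp p) = 1"


section \<open>Contraction semigroups on real L2 spaces\<close>

text \<open>
  Elements of L2 are represented by functions; equality in L2 is equality almost
  everywhere.
\<close>

definition L2_space :: "'a measure \<Rightarrow> ('a \<Rightarrow> real) set" where
  "L2_space M = {f \<in> borel_measurable M. integrable M (\<lambda>x. (f x)\<^sup>2)}"

definition L2_norm :: "'a measure \<Rightarrow> ('a \<Rightarrow> real) \<Rightarrow> real" where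
  "L2_norm M f = sqrt (LINT x|M. (f x)\<^sup>2)"

text \<open>Unbounded operators are given by their graphs.\<close>

definition contraction_semigroup ::
    "'a measure \<Rightarrow> (real \<Rightarrow> ('a \<Rightarrow> real) \<Rightarrow> 'a \<Rightarrow> real) \<Rightarrow> bool" where
  "contraction_semigroup M P \<longleftrightarrow>
     (\<forall>t\<ge>0. \<forall>f\<in>L2_space M. P t f \<in> L2_space M \<and> L2_norm M (P t f) \<le> L2_norm M f) \<and>
     (\<forall>t\<ge>0. \<forall>f\<in>L2_space M. \<forall>g\<in>L2_space M. \<forall>a b.
        AE x in M. P t (\<lambda>y. a * f y + b * g y) x = a * P t f x + b * P t g x) \<and>
     (\<forall>f\<in>L2_space M. AE x in M. P 0 f x = f x) \<and>
     (\<forall>s\<ge>0. \<forall>t\<ge>0. \<forall>f\<in>L2_space M. AE x in M. P (s + t) f x = P s (P t f) x) \<and>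
     (\<forall>f\<in>L2_space M. ((\<lambda>t. L2_norm M (\<lambda>x. P t f x - f x)) \<longlongrightarrow> 0) (at_right 0))"

definition semigroup_generator ::
    "'a measure \<Rightarrow> (real \<Rightarrow> ('a \<Rightarrow> real) \<Rightarrow> 'a \<Rightarrow> real) \<Rightarrow> (('a \<Rightarrow> real) \<times> ('a \<Rightarrow> real)) set" where
  "semigroup_generator M P =
     {(f, g). f \<in> L2_space M \<and> g \<in> L2_space M \<and>
        ((\<lambda>t. L2_norm M (\<lambda>x. (P t f x - f x) / t - g x)) \<longlongrightarrow> 0) (at_right 0)}"


section \<open>Homogeneous hierarchical Laplacians and their heat kernels\<close>

text \<open>Locally constant functions with compact support.\<close>

definition test_functions :: "nat \<Rightarrow> ((int \<Rightarrow> nat) \<Rightarrow> real) set" where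
  "test_functions p =
     {f. (\<forall>x\<in>Qp p. \<exists>U. openin (Qp_top p) U \<and> x \<in> U \<and> (\<forall>y\<in>U. f y = f x)) \<and>
         (\<exists>C. compactin (Qp_top p) C \<and> (\<forall>x\<in>Qp p - C. f x = 0))}"

definition hierarchical_laplacian ::
    "nat \<Rightarrow> (int \<Rightarrow> nat) measure \<Rightarrow> (int \<Rightarrow> real) \<Rightarrow> ((int \<Rightarrow> nat) \<Rightarrow> real) \<Rightarrow> (int \<Rightarrow> nat) \<Rightarrow> real" where
  "hierarchical_laplacian p M lam f x =
     (\<Sum>\<^sub>\<infinity>k\<in>UNIV. (lam k - lam (k + 1)) *
        (f x - (LINT y:pball p x k|M. f y) / measure M (pball p x k)))"

text \<open>
  The self-adjoint extension: as the Laplacian is essentially self-adjoint on the test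
  functions, its only self-adjoint extension is its closure in L2.
\<close>

definition laplacian_closure ::
    "nat \<Rightarrow> (int \<Rightarrow> nat) measure \<Rightarrow> (int \<Rightarrow> real) \<Rightarrow>
     (((int \<Rightarrow> nat) \<Rightarrow> real) \<times> ((int \<Rightarrow> nat) \<Rightarrow> real)) set" where
  "laplacian_closure p M lam =
     {(f, g). f \<in> L2_space M \<and> g \<in> L2_space M \<and>
        (\<exists>\<phi>::nat \<Rightarrow> (int \<Rightarrow> nat) \<Rightarrow> real. (\<forall>n. \<phi> n \<in> test_functions p) \<and>
           (\<lambda>n. L2_norm M (\<lambda>x. \<phi> n x - f x)) \<longlonglongrightarrow> 0 \<and>
           (\<lambda>n. L2_norm M (\<lambda>x. hierarchical_laplacian p M lam (\<phi> n) x - g x)) \<longlonglongrightarrow> 0)}"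

text \<open>
  The semigroup \<open>exp (- t L)\<close> of the non-negative self-adjoint operator \<open>L\<close> is the strongly
  continuous contraction semigroup whose generator is exactly \<open>- L\<close>.
\<close>

definition heat_semigroup ::
    "nat \<Rightarrow> (int \<Rightarrow> nat) measure \<Rightarrow> (int \<Rightarrow> real) \<Rightarrow>
     (real \<Rightarrow> ((int \<Rightarrow> nat) \<Rightarrow> real) \<Rightarrow> (int \<Rightarrow> nat) \<Rightarrow> real) \<Rightarrow> bool" where
  "heat_semigroup p M lam P \<longleftrightarrow>
     contraction_semigroup M P \<and>
     semigroup_generator M P = {(f, \<lambda>x. - g x) | f g. (f, g) \<in> laplacian_closure p M lam}"

definition heat_kernel ::
    "nat \<Rightarrow> (int \<Rightarrow> nat) measure \<Rightarrow> (int \<Rightarrow> real) \<Rightarrow>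
     (real \<Rightarrow> (int \<Rightarrow> nat) \<Rightarrow> (int \<Rightarrow> nat) \<Rightarrow> real) \<Rightarrow> bool" where
  "heat_kernel p M lam K \<longleftrightarrow>
     (\<forall>t>0. continuous_map (prod_topology (Qp_top p) (Qp_top p)) euclideanreal (\<lambda>(x, y). K t x y)) \<and>
     (\<exists>P. heat_semigroup p M lam P \<and>
        (\<forall>t>0. \<forall>f\<in>L2_space M. AE x in M.
           integrable M (\<lambda>y. K t x y * f y) \<and> P t f x = (LINT y|M. K t x y * f y)))"

definition power_eigenvalues :: "nat \<Rightarrow> real \<Rightarrow> real \<Rightarrow> int \<Rightarrow> real" where
  "power_eigenvalues p c \<alpha> k = (c / real p powi k) powr \<alpha>"

text \<open>The eigenvalues of the fractional derivative of order \<open>\<alpha>\<close>.\<close>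

abbreviation fractional_eigenvalues :: "nat \<Rightarrow> real \<Rightarrow> int \<Rightarrow> real" where
  "fractional_eigenvalues p \<alpha> \<equiv> power_eigenvalues p (real p) \<alpha>"

end

theory Submission
  imports Defs "HOL-Real_Asymp.Real_Asymp"
begin

text \<open>
  \<^bold>\<open>The heat kernel on the diagonal.\<close> Let \<open>B\<^sub>k\<close> be the ball of radius \<open>p\<^sup>k\<close> around a point \<open>x\<close>. The
  difference \<open>w\<^sub>k\<close> of the normalised indicators of \<open>B\<^sub>k\<close> and \<open>B\<^sub>k\<^sub>+\<^sub>1\<close> is constant on every ball of
  radius at most \<open>p\<^sup>k\<close> and has mean 0 over every larger ball. Averaging at scale \<open>i\<close> therefore
  reproduces it for \<open>i \<le> k\<close> and kills it for \<open>i > k\<close>, and the Laplacian multiplies it by the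
  telescoping sum of the \<open>\<lambda>\<^sub>i - \<lambda>\<^sub>i\<^sub>+\<^sub>1\<close> with \<open>i > k\<close>, which is \<open>\<lambda>\<^sub>k\<^sub>+\<^sub>1\<close> (\<open>laplacian_ball_wavelet\<close>). A
  contraction semigroup acts on an eigenvector of its generator by the exponential factor
  (\<open>semigroup_eigenvector\<close>). The normalised indicator of \<open>B\<^sub>j\<close> is the sum of the \<open>w\<^sub>i\<close> with
  \<open>j \<le> i < N\<close> and of the normalised indicator of \<open>B\<^sub>N\<close>, whose L2 norm is \<open>p\<close> to the power \<open>- N / 2\<close>.
  Applying the semigroup writes the means of the kernel over \<open>B\<^sub>j\<close> as a partial sum of exponentials
  plus a remainder of small norm, and letting \<open>B\<^sub>j\<close> shrink to \<open>x\<close> while \<open>N\<close> grows faster gives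
  \<open>K(t, x, x) = \<Sum>i. exp (- t \<lambda>\<^sub>i\<^sub>+\<^sub>1) (p\<^sup>-\<^sup>i - p\<^sup>-\<^sup>i\<^sup>-\<^sup>1)\<close> (\<open>heat_kernel_diag_limit\<close>).

  \<^bold>\<open>Periodicity.\<close> Put \<open>h(u) = u exp (- u\<^sup>\<alpha>)\<close> and \<open>H(u) = \<Sum>j. h(u p\<^sup>j)\<close>, where \<open>j\<close> runs through the
  integers. For the eigenvalues \<open>(c / p\<^sup>k)\<^sup>\<alpha>\<close> the series above is a multiple of \<open>H\<close> at
  \<open>t\<^sup>1\<^sup>/\<^sup>\<alpha> c\<close>. As \<open>H(p u) = H(u)\<close>, the profile \<open>A(s) = (1 - 1 / p) H(p\<^sup>s\<^sup>/\<^sup>\<alpha>)\<close> has the period \<open>\<alpha>\<close>.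

  \<^bold>\<open>Non-constancy.\<close> If \<open>H\<close> were a constant, then its integral over one period against a
  non-trivial character of the multiplicative group modulo powers of \<open>p\<close> would vanish. Unfolding
  the sum, this integral is the Mellin transform of \<open>exp (- x)\<close>, that is, a value of the Gamma
  function, and the Gamma function has no zeros (\<open>lattice_sum_not_constant\<close>).

  \<^bold>\<open>Extreme values.\<close> Since \<open>h(u)\<close> is bounded by \<open>u\<close> and by a multiple of \<open>1 / u\<close>, at most two
  neighbouring terms of \<open>H\<close> matter when \<open>p\<close> is large (\<open>lattice_sum_bound\<close>). The maximum of \<open>H\<close>
  is therefore close to that of \<open>h\<close>. The minimum lies where the term \<open>h(u)\<close>, about \<open>u\<close> for
  small \<open>u\<close>, takes over from the decaying term \<open>h(p u)\<close>. This happens when \<open>exp (- (p u)\<^sup>\<alpha>)\<close> is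
  of the order of \<open>1 / p\<close>, so for \<open>u\<close> near \<open>(log p)\<^sup>1\<^sup>/\<^sup>\<alpha> / p\<close>.
\<close>

section \<open>Carries and the digit description of the metric\<close>

lemma int_recursion:
  fixes F :: "int \<Rightarrow> 'a \<Rightarrow> 'a"
  shows "\<exists>c. (\<forall>n\<le>N. c n = a) \<and> (\<forall>n\<ge>N. c (n + 1) = F n (c n))"
proof -
  define c where "c n = rec_nat a (\<lambda>k. F (N + int k)) (nat (n - N))" for n
  have "c n = a" if "n \<le> N" for n using that by (simp add: c_def)
  moreover have "c (n + 1) = F n (c n)" if "n \<ge> N" for n
  proof -
    have "nat (n + 1 - N) = Suc (nat (n - N))" using that by simp
    then show ?thesis using that by (simp add: c_def)
  qed
  ultimately show ?thesis by blast
qed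

lemma int_least_witness:
  fixes P :: "int \<Rightarrow> bool"
  assumes "P k" and "\<And>i. i < N \<Longrightarrow> \<not> P i"
  shows "\<exists>m. P m \<and> (\<forall>i<m. \<not> P i)"
proof -
  have "N \<le> k" using assms by force
  then have ex: "P (N + int (nat (k - N)))" using assms(1) by simp
  define m where "m = (LEAST n. P (N + int n))"
  have "P (N + int m)" unfolding m_def by (rule LeastI, rule ex)
  moreover have "\<not> P i" if "i < N + int m" for i
  proof (cases "i < N")
    case False
    then have "nat (i - N) < m" "i = N + int (nat (i - N))" using that by auto
    then show ?thesis using not_less_Least m_def by metis
  qed (use assms in auto)
  ultimately show ?thesis by blast
qed

text \<open>
  The property by which \<open>carry\<close> is selected, separated from the definite description.
\<close>
definition is_carry :: "nat \<Rightarrow> (int \<Rightarrow> nat) \<Rightarrow> (int \<Rightarrow> nat) \<Rightarrow> bool" where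
  "is_carry p s c \<longleftrightarrow> (\<exists>N. \<forall>n<N. c n = 0) \<and> (\<forall>n. c (n + 1) = (s n + c n) div p)"

text \<open>
  Carries propagate upwards only, so they are determined by the lower positions. This gives
  uniqueness of the carry, and later that the first non-zero digit of an increment is the first
  digit that it changes.
\<close>
lemma is_carry_local:
  assumes c: "is_carry p s c" and c': "is_carry p s' c'" and s: "\<And>i. i < n \<Longrightarrow> s i = s' i"
  shows "c n = c' n"
proof -
  obtain N1 N2 where N: "\<And>i. i < N1 \<Longrightarrow> c i = 0" "\<And>i. i < N2 \<Longrightarrow> c' i = 0"
    using c c' unfolding is_carry_def by blast
  define N where "N = min (min N1 N2 - 1) n"
  have "N \<le> n" by (simp add: N_def)
  have "m \<le> n \<longrightarrow> c m = c' m" if "N \<le> m" for m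
    using that
  proof (induction m rule: int_ge_induct)
    case base
    then show ?case using N by (simp add: N_def)
  next
    case (step i)
    then show ?case using c c' s[of i] unfolding is_carry_def by auto
  qed
  then show ?thesis using \<open>N \<le> n\<close> by blast
qed

lemma carry_eqI: "is_carry p s c \<Longrightarrow> carry p s = c"
  unfolding carry_def is_carry_def[symmetric]
  by (rule the_equality) (auto intro!: ext dest: is_carry_local)

lemma is_carry_carry:
  assumes "\<And>n. n < N \<Longrightarrow> s n = 0"
  shows "is_carry p s (carry p s)"
proof -
  obtain c where c: "\<And>n. n \<le> N \<Longrightarrow> c n = 0" "\<And>n. N \<le> n \<Longrightarrow> c (n + 1) = (s n + c n) div p"
    using int_recursion[of N "0::nat" "\<lambda>n c. (s n + c) div p"] by blast
  have "c (n + 1) = (s n + c n) div p" for n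
    using c assms[of n] by (cases "N \<le> n") auto
  then have "is_carry p s c"
    using c(1) unfolding is_carry_def by (meson less_imp_le)
  then show ?thesis using carry_eqI by metis
qed

lemma Qp_less: "x \<in> Qp p \<Longrightarrow> x n < p"
  by (simp add: Qp_def)

lemma Qp_common_bound:
  assumes "x \<in> Qp p" "y \<in> Qp p"
  shows "\<exists>N. \<forall>n<N. x n = 0 \<and> y n = 0"
proof -
  obtain N1 N2 where "\<And>n. n < N1 \<Longrightarrow> x n = 0" "\<And>n. n < N2 \<Longrightarrow> y n = 0"
    using assms unfolding Qp_def by blast
  then show ?thesis by (intro exI[of _ "min N1 N2"]) auto
qed

lemma is_carry_padd:
  assumes "x \<in> Qp p" "y \<in> Qp p"
  shows "is_carry p (\<lambda>i. x i + y i) (carry p (\<lambda>i. x i + y i))"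
proof -
  obtain N where "\<forall>n<N. x n = 0 \<and> y n = 0" using Qp_common_bound assms by blast
  then show ?thesis by (intro is_carry_carry[of N]) auto
qed

lemma is_carry_zero: "x \<in> Qp p \<Longrightarrow> is_carry p x (\<lambda>_. 0)"
  by (auto simp: is_carry_def Qp_less)

lemma padd_in_Qp:
  assumes "x \<in> Qp p" "y \<in> Qp p"
  shows "padd p x y \<in> Qp p"
proof -
  obtain N where N: "\<forall>n<N. x n = 0 \<and> y n = 0" using Qp_common_bound assms by blast
  obtain N' where N': "\<forall>n<N'. carry p (\<lambda>i. x i + y i) n = 0"
    using is_carry_padd[OF assms] unfolding is_carry_def by blast
  have "p > 0" using Qp_less[OF assms(1), of 0] by simp
  moreover have "\<forall>n<min N N'. padd p x y n = 0"
    using N N' by (simp add: padd_def)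
  ultimately show ?thesis unfolding Qp_def by (auto simp: padd_def simp del: min_less_iff_conj)
qed

text \<open>
  At the first non-zero digit of \<open>z\<close> no carry arrives yet, so adding \<open>z\<close> changes exactly that
  digit first. This is the link between the norm and digit functions.
\<close>
lemma padd_agree_iff:
  assumes x: "x \<in> Qp p" and z: "z \<in> Qp p"
  shows "(\<forall>i<j. padd p x z i = x i) \<longleftrightarrow> (\<forall>i<j. z i = 0)"
proof -
  have no_carry: "padd p x z n = (x n + z n) mod p" if "\<And>i. i < n \<Longrightarrow> z i = 0" for n
    using is_carry_local[OF is_carry_padd[OF x z] is_carry_zero[OF x], of n] that
    by (simp add: padd_def)
  show ?thesis
  proof
    assume "\<forall>i<j. z i = 0"
    then show "\<forall>i<j. padd p x z i = x i" using no_carry Qp_less[OF x] by simp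
  next
    assume eq: "\<forall>i<j. padd p x z i = x i"
    show "\<forall>i<j. z i = 0"
    proof (rule ccontr)
      assume "\<not> (\<forall>i<j. z i = 0)"
      then obtain k where k: "k < j" "z k \<noteq> 0" by blast
      obtain N where "\<And>n. n < N \<Longrightarrow> z n = 0" using z unfolding Qp_def by blast
      then obtain m where m: "z m \<noteq> 0" "\<And>i. i < m \<Longrightarrow> z i = 0"
        using int_least_witness[of "\<lambda>n. z n \<noteq> 0" k N] k by auto
      have "m < j" using m(2)[of k] k by linarith
      moreover have "padd p x z m = (x m + z m) mod p" by (rule no_carry) (rule m(2))
      ultimately have e: "(x m + z m) mod p = x m" using eq by simp
      show False
      proof (cases "x m + z m < p")
        case True then show False using e m(1) by simp
      next
        case False
        then have "(x m + z m) mod p = x m + z m - p"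
          using Qp_less[OF x, of m] Qp_less[OF z, of m] by (simp add: mod_if)
        then show False using e Qp_less[OF z, of m] False by linarith
      qed
    qed
  qed
qed

text \<open>
  Schoolbook subtraction: \<open>c\<close> below is the sequence of borrows, which are also the carries
  of the sum of \<open>y\<close> and the difference.
\<close>
lemma padd_surj:
  assumes x: "x \<in> Qp p" and y: "y \<in> Qp p"
  shows "\<exists>z\<in>Qp p. padd p y z = x"
proof -
  obtain N where N: "\<And>n. n < N \<Longrightarrow> x n = 0 \<and> y n = 0" using Qp_common_bound[OF x y] by blast
  obtain c where c: "\<And>n. n \<le> N \<Longrightarrow> c n = 0"
      "\<And>n. N \<le> n \<Longrightarrow> c (n + 1) = (if y n + c n \<le> x n then 0 else 1::nat)"
    using int_recursion[of N "0::nat" "\<lambda>n c. if y n + c \<le> x n then 0 else 1"] by blast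
  have rec: "c (n + 1) = (if y n + c n \<le> x n then 0 else 1)" for n
    using c(1)[of n] c(1)[of "n+1"] c(2)[of n] N[of n] by (cases "N \<le> n") auto
  have c1: "c n \<le> 1" for n using rec[of "n - 1"] by simp
  define z where "z n = x n + p * c (n + 1) - (y n + c n)" for n
  have ge: "y n + c n \<le> x n + p * c (n + 1)" for n
    using rec[of n] c1[of n] Qp_less[OF y, of n] by auto
  have z_less: "z n < p" for n
    using rec[of n] Qp_less[OF x, of n] by (auto simp: z_def)
  have "z n = 0" if "n < N" for n using N[OF that] c(1) that by (simp add: z_def)
  then have zQ: "z \<in> Qp p" using z_less unfolding Qp_def by blast
  have sum: "y n + z n + c n = x n + p * c (n + 1)" for n using ge[of n] by (simp add: z_def)
  have "c (n + 1) = (y n + z n + c n) div p" for n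
    unfolding sum using Qp_less[OF x, of n] by simp
  then have "is_carry p (\<lambda>i. y i + z i) c"
    unfolding is_carry_def using c(1) by (metis less_imp_le)
  then have "padd p y z = x"
    by (simp add: padd_def carry_eqI sum Qp_less[OF x])
  with zQ show ?thesis by blast
qed

lemma padd_cancel:
  assumes y: "y \<in> Qp p" and z: "z \<in> Qp p" and z': "z' \<in> Qp p" and eq: "padd p y z = padd p y z'"
  shows "z = z'"
proof (rule ccontr)
  assume "z \<noteq> z'"
  then obtain k where "z k \<noteq> z' k" by blast
  moreover obtain N where "\<forall>n<N. z n = 0 \<and> z' n = 0" using Qp_common_bound[OF z z'] by blast
  ultimately obtain m where m: "z m \<noteq> z' m" "\<And>i. i < m \<Longrightarrow> z i = z' i"
    using int_least_witness[of "\<lambda>n. z n \<noteq> z' n" k N] by auto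
  have ceq: "carry p (\<lambda>i. y i + z i) m = carry p (\<lambda>i. y i + z' i) m"
    using is_carry_local[OF is_carry_padd[OF y z] is_carry_padd[OF y z']] m(2) by simp
  define a where "a = y m + carry p (\<lambda>i. y i + z' i) m"
  have "(a + z m) mod p = (a + z' m) mod p"
    using fun_cong[OF eq, of m] ceq by (simp add: padd_def a_def ac_simps)
  then have "int (a + z m) mod int p = int (a + z' m) mod int p"
    by (metis of_nat_mod)
  then have "int p dvd int (z m) - int (z' m)"
    by (simp add: mod_eq_dvd_iff)
  then have "int p dvd int (z' m) - int (z m)" "int p dvd int (z m) - int (z' m)"
    by (simp_all add: dvd_diff_commute)
  then have "z m = z' m"
    using Qp_less[OF z, of m] Qp_less[OF z', of m]
      zdvd_imp_le[of "int p" "int (z m) - int (z' m)"] zdvd_imp_le[of "int p" "int (z' m) - int (z m)"]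
    by linarith
  then show False using m(1) by simp
qed

lemma pdiff_props:
  assumes "x \<in> Qp p" "y \<in> Qp p"
  shows "pdiff p x y \<in> Qp p" "padd p y (pdiff p x y) = x"
proof -
  have "\<exists>!z. z \<in> Qp p \<and> padd p y z = x"
    using padd_surj[OF assms] padd_cancel[OF assms(2)] by blast
  from theI'[OF this] show "pdiff p x y \<in> Qp p" "padd p y (pdiff p x y) = x"
    by (simp_all add: pdiff_def)
qed

lemma pdist_eq_first_difference:
  assumes "x \<in> Qp p" "y \<in> Qp p"
  shows "\<exists>m. pdist p x y = (if x = y then 0 else real p powi (- m)) \<and>
     (\<forall>i<m. x i = y i) \<and> (x \<noteq> y \<longrightarrow> x m \<noteq> y m)"
proof -
  define z where "z = pdiff p x y"
  have z: "z \<in> Qp p" "padd p y z = x" using pdiff_props[OF assms] by (simp_all add: z_def)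
  have agree: "(\<forall>i<j. x i = y i) \<longleftrightarrow> (\<forall>i<j. z i = 0)" for j
    using padd_agree_iff[OF assms(2) z(1)] by (simp add: z(2))
  have eq0: "x = y \<longleftrightarrow> z = (\<lambda>_. 0)" 
  proof
    assume "x = y" then have "z i = 0" for i using agree[of "i+1"] by simp
    then show "z = (\<lambda>_. 0)" by blast
  next
    assume "z = (\<lambda>_. 0)" then have "x i = y i" for i using agree[of "i+1"] by simp
    then show "x = y" by blast
  qed
  show ?thesis
  proof (cases "x = y")
    case True
    then show ?thesis using assms eq0 by (simp add: pdist_def pnorm_def z_def)
  next
    case False
    then obtain k where "z k \<noteq> 0" using eq0 by blast
    moreover obtain N where "\<forall>n<N. z n = 0" using z(1) unfolding Qp_def by blast
    ultimately obtain m where m: "z m \<noteq> 0" "\<And>i. i < m \<Longrightarrow> z i = 0"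
      using int_least_witness[of "\<lambda>n. z n \<noteq> 0" k N] by auto
    have "(LEAST k. z k \<noteq> 0) = m"
      using m by (intro Least_equality) (auto simp: not_less[symmetric])
    then have "pdist p x y = real p powi (- m)"
      using assms False eq0 by (simp add: pdist_def pnorm_def z_def)
    moreover have "x m \<noteq> y m"
    proof
      assume "x m = y m"
      moreover have "\<forall>i<m. x i = y i" using agree m(2) by blast
      ultimately have "\<forall>i<m+1. x i = y i" by (metis zless_add1_eq)
      then show False using agree[of "m+1"] m(1) by simp
    qed
    moreover have "\<forall>i<m. x i = y i" using agree m(2) by blast
    ultimately show ?thesis using False by auto
  qed
qed


lemma powi_le_iff: "2 \<le> p \<Longrightarrow> real p powi a \<le> real p powi b \<longleftrightarrow> a \<le> b"
  using power_int_increasing[of a b "real p"] power_int_strict_increasing[of b a "real p"] by force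

text \<open>
  From here on the metric is only used in this form: balls are cylinder sets of digit
  functions.
\<close>
lemma pdist_le_iff:
  assumes "2 \<le> p" and x: "x \<in> Qp p" and y: "y \<in> Qp p"
  shows "pdist p x y \<le> real p powi k \<longleftrightarrow> (\<forall>i< - k. x i = y i)"
proof -
  obtain m where m: "pdist p x y = (if x = y then 0 else real p powi (- m))"
     "\<forall>i<m. x i = y i" "x \<noteq> y \<longrightarrow> x m \<noteq> y m"
    using pdist_eq_first_difference[OF x y] by blast
  show ?thesis
  proof (cases "x = y")
    case True
    then show ?thesis using m(1) by simp
  next
    case False
    then have "pdist p x y \<le> real p powi k \<longleftrightarrow> - m \<le> k" using m(1) powi_le_iff[OF assms(1)] by simp
    also have "\<dots> \<longleftrightarrow> (\<forall>i< - k. x i = y i)"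
    proof
      assume "- m \<le> k"
      then show "\<forall>i< - k. x i = y i" using m(2) by simp
    next
      assume agree: "\<forall>i< - k. x i = y i"
      show "- m \<le> k"
      proof (rule ccontr)
        assume "\<not> - m \<le> k"
        then have "m < - k" by linarith
        then show False using agree m(3) False by blast
      qed
    qed
    finally show ?thesis .
  qed
qed

lemma pdist_commute: "pdist p x y = pdist p y x"
proof (cases "x \<in> Qp p \<and> y \<in> Qp p")
  case True
  obtain m where m: "pdist p x y = (if x = y then 0 else real p powi (- m))"
     "\<forall>i<m. x i = y i" "x \<noteq> y \<longrightarrow> x m \<noteq> y m"
    using pdist_eq_first_difference[of x p y] True by blast
  obtain n where n: "pdist p y x = (if y = x then 0 else real p powi (- n))"
     "\<forall>i<n. y i = x i" "y \<noteq> x \<longrightarrow> y n \<noteq> x n"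
    using pdist_eq_first_difference[of y p x] True by blast
  show ?thesis
  proof (cases "x = y")
    case False
    have "\<not> m < n" "\<not> n < m" using m(2,3) n(2,3) False by force+
    then have "m = n" by linarith
    then show ?thesis using m(1) n(1) by auto
  qed simp
qed (auto simp: pdist_def)

lemma pdist_nonneg: "0 \<le> pdist p x y"
proof (cases "x \<in> Qp p \<and> y \<in> Qp p")
  case True
  then show ?thesis using pdist_eq_first_difference[of x p y] by force
qed (auto simp: pdist_def)

lemma Metric_space_Qp:
  assumes "2 \<le> p"
  shows "Metric_space (Qp p) (pdist p)"
proof
  fix x y z
  show "0 \<le> pdist p x y" by (rule pdist_nonneg)
  show "pdist p x y = pdist p y x" by (rule pdist_commute)
  assume x: "x \<in> Qp p" and y: "y \<in> Qp p"
  show "pdist p x y = 0 \<longleftrightarrow> x = y"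
    using pdist_eq_first_difference[OF x y] assms by force
  assume z: "z \<in> Qp p"
  have "pdist p x z \<le> max (pdist p x y) (pdist p y z)"
  proof (cases "x = y \<or> y = z")
    case True
    then show ?thesis by auto
  next
    case False
    then obtain a b where ab: "pdist p x y = real p powi a" "pdist p y z = real p powi b"
      using pdist_eq_first_difference[OF x y] pdist_eq_first_difference[OF y z] by metis
    define k where "k = max a b"
    have "pdist p x y \<le> real p powi k" "pdist p y z \<le> real p powi k"
      unfolding ab by (simp_all add: powi_le_iff[OF assms] k_def)
    then have "pdist p x z \<le> real p powi k"
      using x y z assms by (simp add: pdist_le_iff)
    also have "\<dots> = max (pdist p x y) (pdist p y z)"
      unfolding ab k_def using powi_le_iff[OF assms] by (auto simp: max_def)
    finally show ?thesis .
  qed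
  then show "pdist p x z \<le> pdist p x y + pdist p y z"
    using pdist_nonneg[of p x y] pdist_nonneg[of p y z] by linarith
qed

section \<open>Balls and their Haar measure\<close>

lemma pball_eq_cylinder:
  assumes "2 \<le> p" "x \<in> Qp p"
  shows "pball p x k = {y \<in> Qp p. \<forall>i< - k. y i = x i}"
  unfolding pball_def Metric_space.mcball_def[OF Metric_space_Qp[OF assms(1)]]
  using assms pdist_le_iff[OF assms] by auto

lemma openin_Qp_top_iff:
  assumes p: "2 \<le> p"
  shows "openin (Qp_top p) U \<longleftrightarrow> U \<subseteq> Qp p \<and> (\<forall>x\<in>U. \<exists>k. pball p x k \<subseteq> U)"
proof -
  interpret Metric_space "Qp p" "pdist p" by (rule Metric_space_Qp[OF p])
  have "(\<exists>r>0. mball x r \<subseteq> U) \<longleftrightarrow> (\<exists>k. pball p x k \<subseteq> U)" for x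
  proof
    assume "\<exists>r>0. mball x r \<subseteq> U"
    then obtain r where r: "r > 0" "mball x r \<subseteq> U" by blast
    obtain n where "(1 / real p) ^ n < r"
      using real_arch_pow_inv[OF r(1), of "1 / real p"] p by auto
    then have "real p powi (- int n) < r"
      by (simp add: power_int_minus power_one_over field_simps)
    then have "pball p x (- int n) \<subseteq> mball x r"
      unfolding pball_def by (rule mcball_subset_mball_concentric)
    then show "\<exists>k. pball p x k \<subseteq> U" using r(2) by blast
  next
    assume "\<exists>k. pball p x k \<subseteq> U"
    then obtain k where "pball p x k \<subseteq> U" by blast
    then have "mball x (real p powi k) \<subseteq> U" unfolding pball_def using mball_subset_mcball by blast
    moreover have "real p powi k > 0" using p by simp
    ultimately show "\<exists>r>0. mball x r \<subseteq> U" by blast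
  qed
  then show ?thesis unfolding Qp_top_def openin_mtopology by blast
qed

lemma topspace_Qp_top: "2 \<le> p \<Longrightarrow> topspace (Qp_top p) = Qp p"
  unfolding Qp_top_def by (rule Metric_space.topspace_mtopology[OF Metric_space_Qp])

lemma pball_self: "2 \<le> p \<Longrightarrow> x \<in> Qp p \<Longrightarrow> x \<in> pball p x k"
  by (simp add: pball_eq_cylinder)

lemma pball_subset_Qp: "2 \<le> p \<Longrightarrow> x \<in> Qp p \<Longrightarrow> pball p x k \<subseteq> Qp p"
  by (auto simp: pball_eq_cylinder)

lemma pball_recentre: "2 \<le> p \<Longrightarrow> x \<in> Qp p \<Longrightarrow> y \<in> pball p x k \<Longrightarrow> pball p y k = pball p x k"
  by (auto simp: pball_eq_cylinder)

lemma pball_mono: "2 \<le> p \<Longrightarrow> x \<in> Qp p \<Longrightarrow> j \<le> k \<Longrightarrow> pball p x j \<subseteq> pball p x k"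
  by (auto simp: pball_eq_cylinder)

lemma openin_pball:
  assumes "2 \<le> p" "x \<in> Qp p"
  shows "openin (Qp_top p) (pball p x k)"
  unfolding openin_Qp_top_iff[OF assms(1)]
  using pball_subset_Qp[OF assms] pball_recentre[OF assms] by (metis order_refl)

text \<open>
  Refining by one digit. The pieces are translates of each other, which fixes the Haar measure
  of all balls from that of one of them.
\<close>
lemma pball_split:
  assumes p: "2 \<le> p" and x: "x \<in> Qp p"
  shows "pball p x k = (\<Union>d<p. pball p (x(- k := d)) (k - 1))" (is ?split)
    and "d < p \<Longrightarrow> x(- k := d) \<in> Qp p"
    and "disjoint_family_on (\<lambda>d. pball p (x(- k := d)) (k - 1)) {..<p}"
proof -
  have Q: "x(- k := d) \<in> Qp p" if "d < p" for d
  proof -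
    obtain N where "\<forall>n<N. x n = 0" using x unfolding Qp_def by blast
    then have "\<forall>n<min N (-k). (x(- k := d)) n = 0" by auto
    moreover have "(x(- k := d)) n < p" for n using x that by (simp add: Qp_def)
    ultimately show ?thesis unfolding Qp_def by blast
  qed
  then show "d < p \<Longrightarrow> x(- k := d) \<in> Qp p" .
  have lt: "i < - (k - 1) \<longleftrightarrow> i < - k \<or> i = - k" for i by auto
  have mem: "y \<in> pball p (x(- k := d)) (k - 1) \<longleftrightarrow> y \<in> pball p x k \<and> y (- k) = d" if "d < p" for y d
    using Q[OF that] x by (auto simp: pball_eq_cylinder[OF p] lt)
  show ?split
    using mem pball_subset_Qp[OF p x] Qp_less by (fastforce simp: lessThan_iff)
  show "disjoint_family_on (\<lambda>d. pball p (x(- k := d)) (k - 1)) {..<p}"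
    using mem by (auto simp: disjoint_family_on_def)
qed

text \<open>
  Koenig's argument: a ball without finite subcover contains a sub-ball with the next smaller
  radius without finite subcover. The digits of the centres stabilise, and the limit point lies in a
  member of the cover that swallows one of the balls.
\<close>
lemma compactin_pball:
  assumes p: "2 \<le> p" and x: "x \<in> Qp p"
  shows "compactin (Qp_top p) (pball p x k)"
  unfolding compactin_def
proof (intro conjI allI impI)
  show "pball p x k \<subseteq> topspace (Qp_top p)"
    using pball_subset_Qp[OF p x] topspace_Qp_top[OF p] by simp
  fix \<U> assume "Ball \<U> (openin (Qp_top p)) \<and> pball p x k \<subseteq> \<Union>\<U>"
  then have op: "\<And>U. U \<in> \<U> \<Longrightarrow> openin (Qp_top p) U" and cov: "pball p x k \<subseteq> \<Union>\<U>" by auto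
  define good where "good B \<longleftrightarrow> (\<exists>\<F>. finite \<F> \<and> \<F> \<subseteq> \<U> \<and> B \<subseteq> \<Union>\<F>)" for B
  show "\<exists>\<F>. finite \<F> \<and> \<F> \<subseteq> \<U> \<and> pball p x k \<subseteq> \<Union>\<F>"
  proof (rule ccontr)
    assume "\<not> ?thesis"
    then have bad0: "\<not> good (pball p x k)" by (simp add: good_def)
    have step: "\<exists>z. z \<in> pball p y j \<and> z \<in> Qp p \<and> \<not> good (pball p z (j - 1))"
      if y: "y \<in> Qp p" and bad: "\<not> good (pball p y j)" for y j
    proof (rule ccontr)
      assume no: "\<not> ?thesis"
      have "good (pball p (y(- j := d)) (j - 1))" if "d < p" for d
        using no pball_split(2)[OF p y that, of j] pball_split(1)[OF p y, of j]
          pball_self[OF p pball_split(2)[OF p y that, of j], of "j - 1"] that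
        by blast
      then have "\<forall>d\<in>{..<p}. \<exists>\<F>. finite \<F> \<and> \<F> \<subseteq> \<U> \<and> pball p (y(- j := d)) (j - 1) \<subseteq> \<Union>\<F>"
        by (simp add: good_def)
      then obtain F where F: "\<And>d. d < p \<Longrightarrow> finite (F d) \<and> F d \<subseteq> \<U> \<and> pball p (y(- j := d)) (j - 1) \<subseteq> \<Union>(F d)"
        by (metis lessThan_iff)
      have "good (pball p y j)"
        unfolding good_def
      proof (intro exI conjI)
        show "finite (\<Union>d<p. F d)" using F by auto
        show "(\<Union>d<p. F d) \<subseteq> \<U>" using F by auto
        show "pball p y j \<subseteq> \<Union>(\<Union>d<p. F d)"
          using F unfolding pball_split(1)[OF p y, of j] by fastforce
      qed
      then show False using bad by blast
    qed
    \<comment> \<open>nested balls without a finite subcover, shrinking to a point\<close>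
    have "\<exists>xs. \<forall>n. (xs n \<in> Qp p \<and> \<not> good (pball p (xs n) (k - int n)) \<and> (n = 0 \<longrightarrow> xs n = x)) \<and>
        xs (Suc n) \<in> pball p (xs n) (k - int n)"
    proof (rule dependent_nat_choice)
      show "\<exists>y. y \<in> Qp p \<and> \<not> good (pball p y (k - int 0)) \<and> (0 = (0::nat) \<longrightarrow> y = x)"
        using x bad0 by auto
    next
      fix y n assume "y \<in> Qp p \<and> \<not> good (pball p y (k - int n)) \<and> (n = 0 \<longrightarrow> y = x)"
      then show "\<exists>z. (z \<in> Qp p \<and> \<not> good (pball p z (k - int (Suc n))) \<and> (Suc n = 0 \<longrightarrow> z = x)) \<and>
          z \<in> pball p y (k - int n)"
        using step[of y "k - int n"] by (auto simp: algebra_simps)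
    qed
    then obtain xs where xs: "\<And>n. xs n \<in> Qp p" "\<And>n. \<not> good (pball p (xs n) (k - int n))"
      "xs 0 = x" "\<And>n. xs (Suc n) \<in> pball p (xs n) (k - int n)" by metis
    have "xs (n + m) \<in> pball p (xs n) (k - int n)" for n m
    proof (induction m)
      case 0 then show ?case using pball_self[OF p xs(1)] by simp
    next
      case (Suc m)
      have "xs (Suc (n + m)) \<in> pball p (xs (n + m)) (k - int n)"
        using xs(4)[of "n + m"] pball_mono[OF p xs(1)[of "n+m"], of "k - int (n + m)" "k - int n"] by auto
      then show ?case using pball_recentre[OF p xs(1) Suc] by simp
    qed
    then have stable: "xs m i = xs n i" if "n \<le> m" "i < int n - k" for m n i
      using that pball_eq_cylinder[OF p xs(1)] le_Suc_ex[OF that(1)] by fastforce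
    \<comment> \<open>The digit at position \<open>i\<close> is fixed from the step \<open>i + k + 1\<close> on.\<close>
    define y where "y i = xs (nat (i + k + 1)) i" for i
    have y_eq: "y i = xs n i" if "i < int n - k" for i n
    proof -
      have "nat (i + k + 1) \<le> n" using that by simp
      moreover have "i < int (nat (i + k + 1)) - k" by (cases "0 \<le> i + k + 1") auto
      ultimately show ?thesis using stable[of "nat (i + k + 1)" n i] by (simp add: y_def)
    qed
    have "y \<in> Qp p"
    proof -
      obtain N where N: "\<forall>i<N. x i = 0" using x unfolding Qp_def by blast
      have "y i = 0" if "i < min N (- k)" for i
        using y_eq[of i 0] that N xs(3) by simp
      moreover have "y i < p" for i unfolding y_def using xs(1) Qp_less by blast
      ultimately show ?thesis unfolding Qp_def by blast
    qed
    then have y_mem: "y \<in> pball p (xs n) (k - int n)" for n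
      using y_eq[of _ n] by (simp add: pball_eq_cylinder[OF p xs(1)])
    then have "y \<in> \<Union>\<U>" using cov xs(3) by (metis diff_zero of_nat_0 subsetD)
    then obtain U where U: "U \<in> \<U>" "y \<in> U" by blast
    then obtain j where j: "pball p y j \<subseteq> U" using op[OF U(1)] openin_Qp_top_iff[OF p] by blast
    define n where "n = nat (k - j)"
    have "pball p (xs n) (k - int n) = pball p y (k - int n)"
      using pball_recentre[OF p xs(1) y_mem] by simp
    also have "\<dots> \<subseteq> pball p y j" using pball_mono[OF p \<open>y \<in> Qp p\<close>] by (simp add: n_def)
    finally have "pball p (xs n) (k - int n) \<subseteq> \<Union>{U}" using j by simp
    then have "good (pball p (xs n) (k - int n))" unfolding good_def using U(1) by blast
    then show False using xs(2) by blast
  qed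
qed

definition pzero :: "int \<Rightarrow> nat" where "pzero = (\<lambda>_. 0)"

lemma pzero_Qp: "2 \<le> p \<Longrightarrow> pzero \<in> Qp p"
  by (auto simp: pzero_def Qp_def)

lemma pball_pzero: "2 \<le> p \<Longrightarrow> pball p pzero k = {y \<in> Qp p. \<forall>i< - k. y i = 0}"
  by (simp add: pball_eq_cylinder[OF _ pzero_Qp]) (simp add: pzero_def)

lemma padd_image_pball:
  assumes p: "2 \<le> p" and x: "x \<in> Qp p"
  shows "padd p x ` pball p pzero k = pball p x k"
proof
  show "padd p x ` pball p pzero k \<subseteq> pball p x k"
    using padd_agree_iff[OF x] padd_in_Qp[OF x]
    by (auto simp: pball_eq_cylinder[OF p x] pball_pzero[OF p])
next
  show "pball p x k \<subseteq> padd p x ` pball p pzero k"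
  proof
    fix y assume y: "y \<in> pball p x k"
    then have yQ: "y \<in> Qp p" using pball_subset_Qp[OF p x] by blast
    then obtain z where z: "z \<in> Qp p" "padd p x z = y" using padd_surj x by blast
    then have "\<forall>i< - k. z i = 0" using y padd_agree_iff[OF x z(1), of "-k"] by (simp add: pball_eq_cylinder[OF p x])
    then have "z \<in> pball p pzero k" using z by (simp add: pball_pzero[OF p])
    then show "y \<in> padd p x ` pball p pzero k" using z by blast
  qed
qed

lemma Zp_eq_pball:
  assumes p: "2 \<le> p"
  shows "Zp p = pball p pzero 0"
proof -
  have "pnorm p x \<le> 1 \<longleftrightarrow> (\<forall>i<0. x i = 0)" if x: "x \<in> Qp p" for x
  proof (cases "x = (\<lambda>_. 0)")
    case False
    then obtain k where "x k \<noteq> 0" by blast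
    moreover obtain N where "\<forall>n<N. x n = 0" using x unfolding Qp_def by blast
    ultimately obtain m where m: "x m \<noteq> 0" "\<And>i. i < m \<Longrightarrow> x i = 0"
      using int_least_witness[of "\<lambda>n. x n \<noteq> 0" k N] by auto
    have "(LEAST k. x k \<noteq> 0) = m"
      using m by (intro Least_equality) (auto simp: not_less[symmetric])
    then have "pnorm p x = real p powi (- m)" using False by (simp add: pnorm_def)
    then have "pnorm p x \<le> 1 \<longleftrightarrow> 0 \<le> m" using powi_le_iff[OF p, of "- m" 0] by simp
    also have "\<dots> \<longleftrightarrow> (\<forall>i<0. x i = 0)" using m by (meson not_less order_less_le_trans)
    finally show ?thesis .
  qed (simp add: pnorm_def)
  then show ?thesis
    by (auto simp: Zp_def pball_pzero[OF p])
qed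

lemma sets_haar_openin: "haar_measure p M \<Longrightarrow> openin (Qp_top p) U \<Longrightarrow> U \<in> sets M"
  by (auto simp: haar_measure_def)

lemma sets_pball: "haar_measure p M \<Longrightarrow> 2 \<le> p \<Longrightarrow> x \<in> Qp p \<Longrightarrow> pball p x k \<in> sets M"
  by (rule sets_haar_openin) (auto intro: openin_pball)

lemma emeasure_pball_translate:
  assumes "haar_measure p M" "2 \<le> p" "x \<in> Qp p"
  shows "emeasure M (pball p x k) = emeasure M (pball p pzero k)"
  using assms sets_pball[OF assms(1,2) pzero_Qp[OF assms(2)]]
  unfolding haar_measure_def by (metis padd_image_pball)

lemma emeasure_pball:
  assumes M: "haar_measure p M" and p: "2 \<le> p" and x: "x \<in> Qp p"
  shows "emeasure M (pball p x k) = ennreal (real p powi k)"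
proof -
  define e where "e k = emeasure M (pball p pzero k)" for k
  have rec: "e k = ennreal (real p) * e (k - 1)" for k
  proof -
    note z = pzero_Qp[OF p]
    have "e k = (\<Sum>d<p. emeasure M (pball p (pzero(- k := d)) (k - 1)))"
      unfolding e_def pball_split(1)[OF p z, of k]
      using pball_split(2)[OF p z] pball_split(3)[OF p z, of k] sets_pball[OF M p]
      by (intro sum_emeasure[symmetric]) auto
    also have "\<dots> = (\<Sum>d<p. e (k - 1))"
      unfolding e_def using pball_split(2)[OF p z] emeasure_pball_translate[OF M p] by (intro sum.cong) auto
    finally show ?thesis by (simp add: ennreal_of_nat_eq_real_of_nat)
  qed
  have "e k = ennreal (real p powi k)"
  proof (induction k rule: int_induct[where k = 0])
    case base
    then show ?case using M Zp_eq_pball[OF p] by (simp add: e_def haar_measure_def)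
  next
    case (step1 i)
    then show ?case using p rec[of "i + 1"]
      by (simp add: power_int_add ennreal_mult[symmetric] mult.commute)
  next
    case (step2 i)
    have "ennreal (real p) * e (i - 1) = ennreal (real p) * ennreal (real p powi (i - 1))"
      using rec[of i] step2 p by (simp add: ennreal_mult[symmetric] power_int_diff)
    then show ?case using p by (simp add: ennreal_mult_cancel_left)
  qed
  then show ?thesis using emeasure_pball_translate[OF M p x] by (simp add: e_def)
qed

lemma measure_pball:
  assumes "haar_measure p M" "2 \<le> p" "x \<in> Qp p"
  shows "measure M (pball p x k) = real p powi k"
  using emeasure_pball[OF assms] by (simp add: measure_def)

section \<open>Semigroups acting on eigenvectors of their generators\<close>

lemma L2_measurable: "f \<in> L2_space M \<Longrightarrow> f \<in> borel_measurable M"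
  by (simp add: L2_space_def)

lemma L2_mult_integrable:
  assumes "f \<in> L2_space M" "g \<in> L2_space M"
  shows "integrable M (\<lambda>x. f x * g x)"
proof (rule Bochner_Integration.integrable_bound)
  show "integrable M (\<lambda>x. (f x)\<^sup>2 + (g x)\<^sup>2)" using assms by (simp add: L2_space_def)
  show "(\<lambda>x. f x * g x) \<in> borel_measurable M"
    using L2_measurable[OF assms(1)] L2_measurable[OF assms(2)] by simp
  have "\<bar>a * b\<bar> \<le> a\<^sup>2 + b\<^sup>2" for a b :: real
  proof -
    have "2 * (\<bar>a\<bar> * \<bar>b\<bar>) \<le> a\<^sup>2 + b\<^sup>2" using sum_squares_bound[of "\<bar>a\<bar>" "\<bar>b\<bar>"] by (simp add: mult.assoc)
    moreover have "0 \<le> \<bar>a\<bar> * \<bar>b\<bar>" by simp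
    ultimately show ?thesis unfolding abs_mult by linarith
  qed
  then show "AE x in M. norm (f x * g x) \<le> norm ((f x)\<^sup>2 + (g x)\<^sup>2)"
    by (auto intro: order_trans)
qed

lemma L2_lincomb:
  assumes f: "f \<in> L2_space M" and g: "g \<in> L2_space M"
  shows "(\<lambda>x. a * f x + b * g x) \<in> L2_space M"
proof -
  have "integrable M (\<lambda>x. a\<^sup>2 * (f x)\<^sup>2 + b\<^sup>2 * (g x)\<^sup>2 + 2 * a * b * (f x * g x))"
    using f g L2_mult_integrable[OF f g] by (simp add: L2_space_def)
  moreover have "a\<^sup>2 * (f x)\<^sup>2 + b\<^sup>2 * (g x)\<^sup>2 + 2 * a * b * (f x * g x) = (a * f x + b * g x)\<^sup>2" for x
    by (simp add: power2_eq_square algebra_simps)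
  ultimately show ?thesis using L2_measurable[OF f] L2_measurable[OF g] by (simp add: L2_space_def)
qed

lemma L2_diff: "f \<in> L2_space M \<Longrightarrow> g \<in> L2_space M \<Longrightarrow> (\<lambda>x. f x - g x) \<in> L2_space M"
  using L2_lincomb[of f M g 1 "-1"] by simp

lemma L2_scale: "f \<in> L2_space M \<Longrightarrow> (\<lambda>x. c * f x) \<in> L2_space M"
  using L2_lincomb[of f M f c 0] by simp

lemma L2_norm_nonneg: "0 \<le> L2_norm M f"
  by (simp add: L2_norm_def)

lemma L2_norm_sq: "(L2_norm M f)\<^sup>2 = (LINT x|M. (f x)\<^sup>2)"
  by (simp add: L2_norm_def)

lemma L2_norm_cong_AE:
  assumes "AE x in M. f x = g x" "f \<in> L2_space M" "g \<in> L2_space M"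
  shows "L2_norm M f = L2_norm M g"
proof -
  have "(LINT x|M. (f x)\<^sup>2) = (LINT x|M. (g x)\<^sup>2)"
    using assms by (intro integral_cong_AE) (auto simp: L2_space_def)
  then show ?thesis by (simp add: L2_norm_def)
qed

lemma L2_norm_scale: "L2_norm M (\<lambda>x. c * f x) = \<bar>c\<bar> * L2_norm M f"
  by (simp add: L2_norm_def power_mult_distrib real_sqrt_mult)

lemma L2_norm_eq_0_AE:
  assumes "f \<in> L2_space M" "L2_norm M f = 0"
  shows "AE x in M. f x = 0"
proof -
  have "(LINT x|M. (f x)\<^sup>2) = 0" using assms(2) by (simp add: L2_norm_def)
  then show ?thesis
    using assms(1) integral_nonneg_eq_0_iff_AE[of M "\<lambda>x. (f x)\<^sup>2"] by (simp add: L2_space_def)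
qed

text \<open>
  Cauchy-Schwarz, from the non-negativity of the integral of \<open>(b f - a g)\<^sup>2\<close> where \<open>a\<close>, \<open>b\<close> are the
  norms of \<open>f\<close>, \<open>g\<close>.
\<close>
lemma L2_inner_le:
  assumes f: "f \<in> L2_space M" and g: "g \<in> L2_space M"
  shows "(LINT x|M. f x * g x) \<le> L2_norm M f * L2_norm M g"
proof -
  define a b where "a = L2_norm M f" and "b = L2_norm M g"
  have ab: "0 \<le> a" "0 \<le> b" by (simp_all add: a_def b_def L2_norm_nonneg)
  have int: "integrable M (\<lambda>x. (f x)\<^sup>2)" "integrable M (\<lambda>x. (g x)\<^sup>2)" "integrable M (\<lambda>x. f x * g x)"
    using f g L2_mult_integrable[OF f g] by (simp_all add: L2_space_def)
  show ?thesis
  proof (cases "a = 0 \<or> b = 0")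
    case True
    then have "AE x in M. f x * g x = 0"
      using L2_norm_eq_0_AE[OF f] L2_norm_eq_0_AE[OF g] by (auto simp: a_def b_def)
    then have "(LINT x|M. f x * g x) = 0" using int(3) by (simp add: integral_eq_zero_AE)
    then show ?thesis using ab by (simp add: a_def b_def)
  next
    case False
    then have pos: "0 < a * b" using ab by simp
    have "0 \<le> (LINT x|M. (b * f x - a * g x)\<^sup>2)" by simp
    also have "\<dots> = (LINT x|M. b\<^sup>2 * (f x)\<^sup>2 + a\<^sup>2 * (g x)\<^sup>2 - 2 * a * b * (f x * g x))"
      by (intro Bochner_Integration.integral_cong) (auto simp: power2_eq_square algebra_simps)
    also have "\<dots> = b\<^sup>2 * a\<^sup>2 + a\<^sup>2 * b\<^sup>2 - 2 * a * b * (LINT x|M. f x * g x)"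
      using int by (simp add: a_def b_def L2_norm_sq)
    finally have "(a * b) * (LINT x|M. f x * g x) \<le> (a * b) * (a * b)"
      by (simp add: power2_eq_square algebra_simps)
    then show ?thesis using pos unfolding a_def b_def by (rule mult_left_le_imp_le)
  qed
qed

lemma L2_norm_triangle:
  assumes f: "f \<in> L2_space M" and g: "g \<in> L2_space M"
  shows "L2_norm M (\<lambda>x. f x + g x) \<le> L2_norm M f + L2_norm M g"
proof -
  have int: "integrable M (\<lambda>x. (f x)\<^sup>2)" "integrable M (\<lambda>x. (g x)\<^sup>2)" "integrable M (\<lambda>x. f x * g x)"
    using f g L2_mult_integrable[OF f g] by (simp_all add: L2_space_def)
  have "(L2_norm M (\<lambda>x. f x + g x))\<^sup>2 = (LINT x|M. (f x)\<^sup>2 + (g x)\<^sup>2 + 2 * (f x * g x))"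
    unfolding L2_norm_sq
    by (intro Bochner_Integration.integral_cong) (auto simp: power2_eq_square algebra_simps)
  also have "\<dots> = (L2_norm M f)\<^sup>2 + (L2_norm M g)\<^sup>2 + 2 * (LINT x|M. f x * g x)"
    using int by (simp add: L2_norm_sq)
  also have "\<dots> \<le> (L2_norm M f + L2_norm M g)\<^sup>2"
    using L2_inner_le[OF f g] by (simp add: power2_sum)
  finally show ?thesis
    using L2_norm_nonneg by (meson add_nonneg_nonneg power2_le_imp_le)
qed

lemma contraction_semigroupD:
  assumes "contraction_semigroup M P"
  shows "\<And>t f. 0 \<le> t \<Longrightarrow> f \<in> L2_space M \<Longrightarrow> P t f \<in> L2_space M"
    "\<And>t f. 0 \<le> t \<Longrightarrow> f \<in> L2_space M \<Longrightarrow> L2_norm M (P t f) \<le> L2_norm M f"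
    "\<And>t f g a b. 0 \<le> t \<Longrightarrow> f \<in> L2_space M \<Longrightarrow> g \<in> L2_space M \<Longrightarrow>
        AE x in M. P t (\<lambda>y. a * f y + b * g y) x = a * P t f x + b * P t g x"
    "\<And>f. f \<in> L2_space M \<Longrightarrow> AE x in M. P 0 f x = f x"
    "\<And>s t f. 0 \<le> s \<Longrightarrow> 0 \<le> t \<Longrightarrow> f \<in> L2_space M \<Longrightarrow> AE x in M. P (s + t) f x = P s (P t f) x"
  using assms by (auto simp: contraction_semigroup_def)

lemma contraction_semigroup_dist:
  assumes P: "contraction_semigroup M P" and t: "0 \<le> t" and f: "f \<in> L2_space M" and g: "g \<in> L2_space M"
  shows "L2_norm M (\<lambda>x. P t f x - P t g x) \<le> L2_norm M (\<lambda>x. f x - g x)"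
proof -
  note D = contraction_semigroupD[OF P]
  have "AE x in M. P t (\<lambda>y. 1 * f y + (-1) * g y) x = 1 * P t f x + (-1) * P t g x"
    by (rule D(3)[OF t f g])
  then have "L2_norm M (\<lambda>x. P t f x - P t g x) = L2_norm M (P t (\<lambda>y. f y - g y))"
    using D(1)[OF t] f g L2_diff by (intro L2_norm_cong_AE) auto
  also have "\<dots> \<le> L2_norm M (\<lambda>x. f x - g x)" by (rule D(2)[OF t L2_diff[OF f g]])
  finally show ?thesis .
qed

text \<open>
  One step of length \<open>s\<close> adds at most one new error, because the semigroup does not enlarge
  the errors made before and the factor \<open>exp (- l s)\<close> is at most 1.
\<close>
lemma semigroup_power_deviation:
  assumes P: "contraction_semigroup M P" and f: "f \<in> L2_space M" and s: "0 \<le> s" and l: "0 \<le> l"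
  shows "L2_norm M (\<lambda>x. P (real n * s) f x - exp (- l * (real n * s)) * f x)
    \<le> real n * L2_norm M (\<lambda>x. P s f x - exp (- l * s) * f x)"
proof (induction n)
  note D = contraction_semigroupD[OF P]
  note f0 = f D(1)[OF _ f]
  case 0
  have "AE x in M. P 0 f x - f x = 0 * f x" using D(4)[OF f] by auto
  then have "L2_norm M (\<lambda>x. P 0 f x - f x) = L2_norm M (\<lambda>x. 0 * f x)"
    using f0 by (intro L2_norm_cong_AE L2_diff L2_scale) auto
  then show ?case by (simp add: L2_norm_def)
next
  note D = contraction_semigroupD[OF P]
  case (Suc n)
  define c where "c = exp (- l * (real n * s))"
  have c: "0 \<le> c" "c \<le> 1" using s l by (simp_all add: c_def)
  have cc: "exp (- l * (real (Suc n) * s)) = c * exp (- l * s)"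
    by (simp add: c_def exp_add[symmetric] algebra_simps)
  define g where "g = P (real n * s) f"
  have g: "g \<in> L2_space M" unfolding g_def by (rule D(1)) (use s f in auto)
  have cf: "(\<lambda>x. c * f x) \<in> L2_space M" by (rule L2_scale[OF f])
  have Ps: "P s f \<in> L2_space M" "P s g \<in> L2_space M" "P s (\<lambda>x. c * f x) \<in> L2_space M"
    using D(1)[OF s] f g cf by auto
  have e1: "AE x in M. P (real (Suc n) * s) f x = P s g x"
  proof -
    have "AE x in M. P (s + real n * s) f x = P s (P (real n * s) f) x"
      by (rule D(5)) (use s f in auto)
    then show ?thesis by (simp add: g_def algebra_simps)
  qed
  have e2: "AE x in M. P s (\<lambda>x. c * f x) x = c * P s f x"
    using D(3)[OF s f f, of c 0] by simp
  have "AE x in M. P (real (Suc n) * s) f x - exp (- l * (real (Suc n) * s)) * f x =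
      (P s g x - P s (\<lambda>x. c * f x) x) + c * (P s f x - exp (- l * s) * f x)"
    using e1 e2 by eventually_elim (simp only: cc, simp add: algebra_simps)
  then have "L2_norm M (\<lambda>x. P (real (Suc n) * s) f x - exp (- l * (real (Suc n) * s)) * f x) =
      L2_norm M (\<lambda>x. (P s g x - P s (\<lambda>x. c * f x) x) + c * (P s f x - exp (- l * s) * f x))"
  proof (rule L2_norm_cong_AE)
    show "(\<lambda>x. P (real (Suc n) * s) f x - exp (- l * (real (Suc n) * s)) * f x) \<in> L2_space M"
      using s f by (intro L2_diff L2_scale D(1)) auto
    show "(\<lambda>x. (P s g x - P s (\<lambda>x. c * f x) x) + c * (P s f x - exp (- l * s) * f x)) \<in> L2_space M"
      using L2_lincomb[OF L2_diff[OF Ps(2,3)] L2_diff[OF Ps(1) L2_scale[OF f, of "exp (- l * s)"]], of 1 c] by simp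
  qed
  also have "\<dots> \<le> L2_norm M (\<lambda>x. P s g x - P s (\<lambda>x. c * f x) x) +
      L2_norm M (\<lambda>x. c * (P s f x - exp (- l * s) * f x))"
    by (intro L2_norm_triangle L2_diff L2_scale Ps f)
  also have "\<dots> \<le> L2_norm M (\<lambda>x. g x - c * f x) + c * L2_norm M (\<lambda>x. P s f x - exp (- l * s) * f x)"
    using contraction_semigroup_dist[OF P s g cf] c by (simp add: L2_norm_scale)
  also have "\<dots> \<le> real n * L2_norm M (\<lambda>x. P s f x - exp (- l * s) * f x) +
      1 * L2_norm M (\<lambda>x. P s f x - exp (- l * s) * f x)"
    using Suc c by (intro add_mono mult_right_mono) (auto simp: g_def c_def L2_norm_nonneg)
  finally show ?case by (simp add: algebra_simps)
qed

text \<open>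
  Cut the time \<open>t\<close> into \<open>n\<close> steps. By the eigenvalue equation each step of length \<open>t / n\<close>
  deviates from multiplication by \<open>exp (- l t / n)\<close> by \<open>o(1 / n)\<close>, and the \<open>n\<close> errors add up
  to \<open>o(1)\<close>.
\<close>
lemma semigroup_eigenvector:
  assumes P: "contraction_semigroup M P" and gen: "(f, \<lambda>x. - (l * f x)) \<in> semigroup_generator M P"
    and l: "0 \<le> l" and t: "0 < t"
  shows "AE x in M. P t f x = exp (- l * t) * f x"
proof -
  note D = contraction_semigroupD[OF P]
  have f: "f \<in> L2_space M" using gen by (simp add: semigroup_generator_def)
  define r where "r s = L2_norm M (\<lambda>x. P s f x - exp (- l * s) * f x)" for s
  define q where "q s = L2_norm M (\<lambda>x. (P s f x - f x) / s + l * f x)" for s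
  have q0: "(q \<longlongrightarrow> 0) (at_right 0)" using gen unfolding q_def by (simp add: semigroup_generator_def)
  have bound: "r s / s \<le> q s + \<bar>(1 - l * s - exp (- l * s)) / s\<bar> * L2_norm M f" if "0 < s" for s
  proof -
    have Pf: "P s f \<in> L2_space M" using D(1)[OF _ f] that by simp
    have dq: "(\<lambda>x. (P s f x - f x) / s + l * f x) \<in> L2_space M"
      using L2_lincomb[OF Pf f, of "1 / s" "l - 1 / s"] that by (simp add: field_simps)
    have "(\<lambda>x. P s f x - exp (- l * s) * f x) =
       (\<lambda>x. s * ((P s f x - f x) / s + l * f x) + (1 - l * s - exp (- l * s)) * f x)"
      using that by (simp add: fun_eq_iff field_simps)
    then have "r s \<le> s * q s + \<bar>1 - l * s - exp (- l * s)\<bar> * L2_norm M f"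
      using L2_norm_triangle[OF L2_scale[OF dq, of s] L2_scale[OF f, of "1 - l * s - exp (- l * s)"]] that
      by (simp only: r_def q_def L2_norm_scale abs_of_pos)
    then show ?thesis using that by (simp add: field_simps abs_mult)
  qed
  have "((\<lambda>s. exp (- l * s)) has_real_derivative - l) (at 0)"
    by (auto intro!: derivative_eq_intros)
  then have "((\<lambda>s. (exp (- l * s) - 1) / s) \<longlongrightarrow> - l) (at 0)"
    by (simp add: has_field_derivative_iff)
  then have "((\<lambda>s. \<bar>- l - (exp (- l * s) - 1) / s\<bar>) \<longlongrightarrow> \<bar>- l - - l\<bar>) (at_right 0)"
    by (intro tendsto_intros) (metis filterlim_at_split)
  moreover have "\<forall>\<^sub>F s in at_right 0. \<bar>- l - (exp (- l * s) - 1) / s\<bar> = \<bar>(1 - l * s - exp (- l * s)) / s\<bar>"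
    using eventually_at_right_less[of "0::real"] by eventually_elim (simp add: field_simps)
  ultimately have "((\<lambda>s. \<bar>(1 - l * s - exp (- l * s)) / s\<bar>) \<longlongrightarrow> 0) (at_right 0)"
    using tendsto_cong by fastforce
  then have "((\<lambda>s. q s + \<bar>(1 - l * s - exp (- l * s)) / s\<bar> * L2_norm M f) \<longlongrightarrow> 0 + 0 * L2_norm M f) (at_right 0)"
    by (intro tendsto_intros q0)
  moreover have "\<forall>\<^sub>F s in at_right 0. 0 \<le> r s / s"
    using eventually_at_right_less[of "0::real"] by eventually_elim (simp add: r_def L2_norm_nonneg)
  moreover have "\<forall>\<^sub>F s in at_right 0. r s / s \<le> q s + \<bar>(1 - l * s - exp (- l * s)) / s\<bar> * L2_norm M f"
    using eventually_at_right_less[of "0::real"] by eventually_elim (rule bound)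
  ultimately have r0: "((\<lambda>s. r s / s) \<longlongrightarrow> 0) (at_right 0)"
    using tendsto_sandwich[OF _ _ tendsto_const] by fastforce
  have "filterlim (\<lambda>n. t / real (Suc n)) (at_right 0) sequentially"
  proof (rule tendsto_imp_filterlim_at_right)
    show "(\<lambda>n. t / real (Suc n)) \<longlonglongrightarrow> 0"
      using LIMSEQ_Suc[OF lim_const_over_n[of t]] by simp
    show "\<forall>\<^sub>F n in sequentially. 0 < t / real (Suc n)" using t by simp
  qed
  from filterlim_compose[OF r0 this]
  have "(\<lambda>n. t * (r (t / real (Suc n)) / (t / real (Suc n)))) \<longlonglongrightarrow> t * 0"
    by (intro tendsto_intros)
  moreover have "t * (r (t / real (Suc n)) / (t / real (Suc n))) = real (Suc n) * r (t / real (Suc n))" for n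
    using t by (simp del: of_nat_Suc)
  ultimately have lim: "(\<lambda>n. real (Suc n) * r (t / real (Suc n))) \<longlonglongrightarrow> 0"
    by simp
  have "r t \<le> real (Suc n) * r (t / real (Suc n))" for n
    using semigroup_power_deviation[OF P f _ l, of "t / real (Suc n)" "Suc n"] t
    by (simp add: r_def del: of_nat_Suc)
  then have "r t \<le> 0" by (intro LIMSEQ_le_const[OF lim]) auto
  then have "L2_norm M (\<lambda>x. P t f x - exp (- l * t) * f x) = 0"
    using L2_norm_nonneg[of M] unfolding r_def by (simp add: order_antisym)
  then have "AE x in M. P t f x - exp (- l * t) * f x = 0"
    using D(1)[OF _ f, of t] t by (intro L2_norm_eq_0_AE L2_diff L2_scale f) auto
  then show ?thesis by auto
qed

section \<open>Wavelets supported on balls\<close>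

definition ball_density :: "nat \<Rightarrow> (int \<Rightarrow> nat) \<Rightarrow> int \<Rightarrow> (int \<Rightarrow> nat) \<Rightarrow> real" where
  "ball_density p x0 k = (\<lambda>x. indicat_real (pball p x0 k) x * real p powi (- k))"

text \<open>
  The difference of two consecutive normalised indicators, a Haar wavelet that is radial
  about \<open>x0\<close>.
\<close>
definition ball_wavelet :: "nat \<Rightarrow> (int \<Rightarrow> nat) \<Rightarrow> int \<Rightarrow> (int \<Rightarrow> nat) \<Rightarrow> real" where
  "ball_wavelet p x0 k = (\<lambda>x. ball_density p x0 k x - ball_density p x0 (k + 1) x)"

lemma ball_density_apply:
  "ball_density p x0 k x = (if x \<in> pball p x0 k then real p powi (- k) else 0)"
  by (simp add: ball_density_def)

context
  fixes p :: nat and M :: "(int \<Rightarrow> nat) measure"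
  assumes p: "2 \<le> p" and M: "haar_measure p M"
begin

lemma space_haar: "space M = Qp p"
  using M by (simp add: haar_measure_def)

lemma integrable_indicat_pball:
  assumes "x0 \<in> Qp p" 
  shows "integrable M (indicat_real (pball p x0 k))" "(LINT x|M. indicat_real (pball p x0 k) x) = real p powi k"
proof -
  have "pball p x0 k \<inter> space M = pball p x0 k" using space_haar pball_subset_Qp[OF p assms] by blast
  then show "(LINT x|M. indicat_real (pball p x0 k) x) = real p powi k"
    using measure_pball[OF M p assms] by simp
  show "integrable M (indicat_real (pball p x0 k))"
    using sets_pball[OF M p assms] emeasure_pball[OF M p assms] by (intro integrable_real_indicator) simp_all
qed

lemma ball_density_L2:
  assumes "x0 \<in> Qp p"
  shows "ball_density p x0 k \<in> L2_space M"
    and "(LINT x|M. ball_density p x0 k x) = 1" and "integrable M (ball_density p x0 k)"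
    and "(L2_norm M (ball_density p x0 k))\<^sup>2 = real p powi (- k)"
proof -
  note I = integrable_indicat_pball[OF assms, of k]
  have pos: "real p > 0" using p by simp
  have sq: "(\<lambda>x. (ball_density p x0 k x)\<^sup>2) = (\<lambda>x. indicat_real (pball p x0 k) x * (real p powi (- k))\<^sup>2)"
    by (auto simp: ball_density_def indicator_def)
  show "integrable M (ball_density p x0 k)" unfolding ball_density_def using I(1) by simp
  then show "ball_density p x0 k \<in> L2_space M" unfolding L2_space_def using I(1) sq
    by (auto dest: borel_measurable_integrable)
  show "(LINT x|M. ball_density p x0 k x) = 1"
    unfolding ball_density_def using I pos by (simp add: power_int_minus)
  show "(L2_norm M (ball_density p x0 k))\<^sup>2 = real p powi (- k)"
    unfolding L2_norm_sq sq using I pos by (simp add: power_int_minus power2_eq_square)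
qed

lemma ball_wavelet_L2:
  assumes "x0 \<in> Qp p"
  shows "ball_wavelet p x0 k \<in> L2_space M"
  unfolding ball_wavelet_def by (intro L2_diff ball_density_L2(1) assms)

lemma ball_density_locally_constant:
  assumes x0: "x0 \<in> Qp p" and x: "x \<in> Qp p" and y: "y \<in> pball p x j" and "j \<le> k"
  shows "ball_density p x0 k y = ball_density p x0 k x"
proof -
  have "y \<in> pball p x k" using pball_mono[OF p x \<open>j \<le> k\<close>] y by blast
  then have yx: "pball p y k = pball p x k" by (rule pball_recentre[OF p x])
  have "y \<in> pball p x0 k \<longleftrightarrow> x \<in> pball p x0 k"
  proof
    assume "y \<in> pball p x0 k"
    then have "pball p y k = pball p x0 k" by (rule pball_recentre[OF p x0])
    then show "x \<in> pball p x0 k" using yx pball_self[OF p x, of k] by simp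
  next
    assume "x \<in> pball p x0 k"
    then have "pball p x k = pball p x0 k" by (rule pball_recentre[OF p x0])
    then show "y \<in> pball p x0 k" using \<open>y \<in> pball p x k\<close> by simp
  qed
  then show ?thesis by (simp add: ball_density_apply)
qed

lemma ball_wavelet_locally_constant:
  assumes x0: "x0 \<in> Qp p" and x: "x \<in> Qp p" and y: "y \<in> pball p x j" and "j \<le> k"
  shows "ball_wavelet p x0 k y = ball_wavelet p x0 k x"
proof -
  have "j \<le> k + 1" using \<open>j \<le> k\<close> by simp
  then show ?thesis unfolding ball_wavelet_def
    by (simp only: ball_density_locally_constant[OF x0 x y \<open>j \<le> k\<close>] ball_density_locally_constant[OF x0 x y])
qed

lemma ball_wavelet_test_function:
  assumes x0: "x0 \<in> Qp p"
  shows "ball_wavelet p x0 k \<in> test_functions p"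
proof -
  have "\<exists>U. openin (Qp_top p) U \<and> x \<in> U \<and> (\<forall>y\<in>U. ball_wavelet p x0 k y = ball_wavelet p x0 k x)"
    if "x \<in> Qp p" for x
  proof (intro exI[of _ "pball p x k"] conjI ballI openin_pball[OF p that] pball_self[OF p that])
    fix y assume "y \<in> pball p x k"
    then show "ball_wavelet p x0 k y = ball_wavelet p x0 k x"
      by (rule ball_wavelet_locally_constant[OF x0 that _ order_refl])
  qed
  moreover
  have "ball_wavelet p x0 k x = 0" if "x \<notin> pball p x0 (k + 1)" for x
    using that pball_mono[OF p x0, of k "k + 1"] by (auto simp: ball_wavelet_def ball_density_apply)
  then have "\<exists>C. compactin (Qp_top p) C \<and> (\<forall>x\<in>Qp p - C. ball_wavelet p x0 k x = 0)"
    using compactin_pball[OF p x0, of "k + 1"] by auto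
  ultimately show ?thesis by (simp add: test_functions_def)
qed

text \<open>
  A ball of radius at most \<open>p\<^sup>k\<close> lies in one piece of constancy of the wavelet. A larger ball
  either contains the support, where the two normalised indicators cancel, or misses it.
\<close>
lemma ball_average_wavelet:
  assumes x0: "x0 \<in> Qp p" and x: "x \<in> Qp p"
  shows "(LINT y:pball p x j|M. ball_wavelet p x0 k y) / measure M (pball p x j) =
    (if j \<le> k then ball_wavelet p x0 k x else 0)"
proof (cases "j \<le> k")
  case True
  have "(LINT y:pball p x j|M. ball_wavelet p x0 k y) =
      (LINT y|M. indicat_real (pball p x j) y * ball_wavelet p x0 k x)"
    unfolding set_lebesgue_integral_def
  proof (rule Bochner_Integration.integral_cong[OF refl])
    fix y
    show "indicat_real (pball p x j) y *\<^sub>R ball_wavelet p x0 k y = indicat_real (pball p x j) y * ball_wavelet p x0 k x"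
      using ball_wavelet_locally_constant[OF x0 x _ True, of y] by (cases "y \<in> pball p x j") auto
  qed
  also have "\<dots> = measure M (pball p x j) * ball_wavelet p x0 k x"
    using integrable_indicat_pball[OF x] measure_pball[OF M p x] by simp
  finally show ?thesis using True measure_pball[OF M p x] p by simp
next
  case False
  have sub: "pball p x0 k \<subseteq> pball p x0 (k + 1)" "pball p x0 (k + 1) \<subseteq> pball p x0 j"
    using pball_mono[OF p x0] False by auto
  have "(LINT y:pball p x j|M. ball_wavelet p x0 k y) = 0"
  proof (cases "x \<in> pball p x0 j")
    case True
    then have "pball p x j = pball p x0 j" using pball_recentre[OF p x0] by blast
    then have "(LINT y:pball p x j|M. ball_wavelet p x0 k y) = (LINT y|M. ball_wavelet p x0 k y)"
      unfolding set_lebesgue_integral_def using sub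
      by (intro Bochner_Integration.integral_cong)
        (auto simp: indicator_def ball_wavelet_def ball_density_apply)
    also have "\<dots> = 0"
      unfolding ball_wavelet_def using ball_density_L2[OF x0] by simp
    finally show ?thesis .
  next
    case notin: False
    have "y \<notin> pball p x0 j" if "y \<in> pball p x j" for y
    proof
      assume "y \<in> pball p x0 j"
      then have "pball p x j = pball p x0 j"
        using pball_recentre[OF p x0] pball_recentre[OF p x that] by blast
      then show False using notin pball_self[OF p x] by blast
    qed
    then have "(LINT y:pball p x j|M. ball_wavelet p x0 k y) = (LINT y|M. 0)"
      unfolding set_lebesgue_integral_def using sub
      by (intro Bochner_Integration.integral_cong)
        (auto simp: indicator_def ball_wavelet_def ball_density_apply)
    then show ?thesis by simp
  qed
  then show ?thesis using False by simp
qed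

lemma telescoping_eigenvalues:
  fixes lam :: "int \<Rightarrow> real"
  assumes decr: "\<And>i. lam (i + 1) \<le> lam i" and lim: "(\<lambda>n. lam (k + int n)) \<longlonglongrightarrow> 0"
  shows "((\<lambda>i. lam i - lam (i + 1)) has_sum lam k) {k..}"
proof -
  have "(\<lambda>n. lam (k + int n) - lam (k + int (Suc n))) sums (lam (k + int 0) - 0)"
    by (rule telescope_sums'[OF lim])
  then have "(\<lambda>n. lam (k + int n) - lam (k + int n + 1)) sums lam k"
    by (simp add: ac_simps)
  then have "((\<lambda>n. lam (k + int n) - lam (k + int n + 1)) has_sum lam k) UNIV"
    using decr by (intro sums_nonneg_imp_has_sum) auto
  moreover have "bij_betw (\<lambda>n. k + int n) UNIV {k..}"
    by (rule bij_betwI[where g = "\<lambda>i. nat (i - k)"]) auto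
  ultimately show ?thesis
    using has_sum_reindex_bij_betw[of "\<lambda>n. k + int n" UNIV "{k..}" "\<lambda>i. lam i - lam (i + 1)" "lam k"] by simp
qed

text \<open>
  Only the scales \<open>i > k\<close> contribute, and each contributes the full value of the wavelet.
\<close>
lemma laplacian_ball_wavelet:
  assumes x0: "x0 \<in> Qp p" and x: "x \<in> Qp p"
    and decr: "\<And>i. lam (i + 1) \<le> lam i" and lim: "(\<lambda>n. lam (k + 1 + int n)) \<longlonglongrightarrow> 0"
  shows "hierarchical_laplacian p M lam (ball_wavelet p x0 k) x = lam (k + 1) * ball_wavelet p x0 k x"
proof -
  have "((\<lambda>i. (lam i - lam (i + 1)) * ball_wavelet p x0 k x) has_sum lam (k + 1) * ball_wavelet p x0 k x) {k + 1..}"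
    by (intro has_sum_cmult_left telescoping_eigenvalues[OF decr lim])
  also have "?this \<longleftrightarrow> ((\<lambda>i. (lam i - lam (i + 1)) * (ball_wavelet p x0 k x -
      (LINT y:pball p x i|M. ball_wavelet p x0 k y) / measure M (pball p x i)))
      has_sum lam (k + 1) * ball_wavelet p x0 k x) UNIV"
    by (intro has_sum_cong_neutral) (auto simp: ball_average_wavelet[OF x0 x])
  finally show ?thesis
    unfolding hierarchical_laplacian_def by (rule infsumI)
qed

lemma ball_wavelet_in_generator:
  assumes P: "heat_semigroup p M lam P" and x0: "x0 \<in> Qp p"
    and decr: "\<And>i. lam (i + 1) \<le> lam i" and lim: "(\<lambda>n. lam (k + 1 + int n)) \<longlonglongrightarrow> 0"
  shows "(ball_wavelet p x0 k, \<lambda>x. - (lam (k + 1) * ball_wavelet p x0 k x)) \<in> semigroup_generator M P"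
proof -
  let ?f = "ball_wavelet p x0 k"
  have f: "?f \<in> L2_space M" by (rule ball_wavelet_L2[OF x0])
  have "L2_norm M (\<lambda>x. hierarchical_laplacian p M lam ?f x - lam (k + 1) * ?f x) = L2_norm M (\<lambda>x. 0)"
    unfolding L2_norm_def
    by (intro arg_cong[where f = sqrt] Bochner_Integration.integral_cong)
      (auto simp: space_haar laplacian_ball_wavelet[OF x0 _ decr lim])
  then have "L2_norm M (\<lambda>x. hierarchical_laplacian p M lam ?f x - lam (k + 1) * ?f x) = 0"
    "L2_norm M (\<lambda>x. ?f x - ?f x) = 0"
    by (simp_all add: L2_norm_def)
  then have "\<exists>\<phi>::nat \<Rightarrow> (int \<Rightarrow> nat) \<Rightarrow> real. (\<forall>n. \<phi> n \<in> test_functions p) \<and>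
      (\<lambda>n. L2_norm M (\<lambda>x. \<phi> n x - ?f x)) \<longlonglongrightarrow> 0 \<and>
      (\<lambda>n. L2_norm M (\<lambda>x. hierarchical_laplacian p M lam (\<phi> n) x - lam (k + 1) * ?f x)) \<longlonglongrightarrow> 0"
    using ball_wavelet_test_function[OF x0, of k] by (intro exI[of _ "\<lambda>_. ?f"]) simp
  then have mem: "(?f, \<lambda>x. lam (k + 1) * ?f x) \<in> laplacian_closure p M lam"
    unfolding laplacian_closure_def using f L2_scale[OF f] by simp
  have gen: "semigroup_generator M P = {(f, \<lambda>x. - g x) | f g. (f, g) \<in> laplacian_closure p M lam}"
    using P by (simp add: heat_semigroup_def)
  show ?thesis unfolding gen
    by (rule CollectI, intro exI[of _ ?f] exI[of _ "\<lambda>x. lam (k + 1) * ?f x"] conjI refl mem)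
qed

end

section \<open>The heat kernel on the diagonal\<close>

context
  fixes p :: nat and M :: "(int \<Rightarrow> nat) measure"
  assumes p: "2 \<le> p" and M: "haar_measure p M"
begin

text \<open>
  The normalised indicator of a ball telescopes into wavelets; the part at infinity is kept as
  a remainder.
\<close>
lemma semigroup_ball_density:
  assumes P: "heat_semigroup p M lam P" and x0: "x0 \<in> Qp p" and t: "0 < t"
    and nonneg: "\<And>i. 0 \<le> lam i"
    and decr: "\<And>i. lam (i + 1) \<le> lam i" and lim: "\<And>k. (\<lambda>n. lam (k + int n)) \<longlonglongrightarrow> 0"
    and "j \<le> N"
  shows "AE x in M. P t (ball_density p x0 j) x =
    (\<Sum>i\<in>{j..<N}. exp (- lam (i + 1) * t) * ball_wavelet p x0 i x) + P t (ball_density p x0 N) x"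
  using \<open>j \<le> N\<close>
proof (induction N rule: int_ge_induct)
  case base
  then show ?case by simp
next
  case (step N)
  have cs: "contraction_semigroup M P" using P by (simp add: heat_semigroup_def)
  have dens: "(\<lambda>x. 1 * ball_wavelet p x0 N x + 1 * ball_density p x0 (N + 1) x) = ball_density p x0 N"
    by (simp add: ball_wavelet_def)
  have "AE x in M. P t (\<lambda>x. 1 * ball_wavelet p x0 N x + 1 * ball_density p x0 (N + 1) x) x =
      1 * P t (ball_wavelet p x0 N) x + 1 * P t (ball_density p x0 (N + 1)) x"
    using t by (intro contraction_semigroupD(3)[OF cs] ball_wavelet_L2[OF p M x0] ball_density_L2(1)[OF p M x0]) auto
  then have "AE x in M. P t (ball_density p x0 N) x =
      1 * P t (ball_wavelet p x0 N) x + 1 * P t (ball_density p x0 (N + 1)) x"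
    unfolding dens .
  moreover have "AE x in M. P t (ball_wavelet p x0 N) x = exp (- lam (N + 1) * t) * ball_wavelet p x0 N x"
  proof (rule semigroup_eigenvector[OF cs _ nonneg t])
    show "(ball_wavelet p x0 N, \<lambda>x. - (lam (N + 1) * ball_wavelet p x0 N x)) \<in> semigroup_generator M P"
      by (rule ball_wavelet_in_generator[OF p M P x0 decr lim])
  qed
  ultimately show ?case
    using step.IH
  proof eventually_elim
    case (elim x)
    have "{j..<N + 1} = insert N {j..<N}" using step.hyps by auto
    then have "(\<Sum>i\<in>{j..<N + 1}. exp (- lam (i + 1) * t) * ball_wavelet p x0 i x) =
       exp (- lam (N + 1) * t) * ball_wavelet p x0 N x + (\<Sum>i\<in>{j..<N}. exp (- lam (i + 1) * t) * ball_wavelet p x0 i x)"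
      by simp
    then show ?case using elim by simp
  qed
qed

text \<open>
  On the small ball \<open>B\<close> of radius \<open>p\<^sup>j\<close>, the semigroup applied to the normalised indicator
  is within \<open>\<epsilon>\<close> of \<open>K x0 x0\<close> by continuity, and it equals the partial sum plus the remainder of
  the telescoping. Hence the remainder is bounded below by the claimed difference minus \<open>\<epsilon>\<close> almost
  everywhere on \<open>B\<close>, whose measure is \<open>p\<^sup>j\<close>, while its squared norm is at most \<open>p\<close> to the power \<open>- N\<close>.
\<close>
lemma heat_kernel_diag_bound:
  assumes P: "heat_semigroup p M lam P" and x0: "x0 \<in> Qp p" and t: "0 < t"
    and nonneg: "\<And>i. 0 \<le> lam i"
    and decr: "\<And>i. lam (i + 1) \<le> lam i" and lim: "\<And>k. (\<lambda>n. lam (k + int n)) \<longlonglongrightarrow> 0"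
    and K: "\<And>f. f \<in> L2_space M \<Longrightarrow>
       AE x in M. integrable M (\<lambda>y. K x y * f y) \<and> P t f x = (LINT y|M. K x y * f y)"
    and close: "\<And>x y. x \<in> pball p x0 j \<Longrightarrow> y \<in> pball p x0 j \<Longrightarrow> \<bar>K x y - K x0 x0\<bar> \<le> \<epsilon>"
    and "j \<le> N"
  shows "\<bar>K x0 x0 - (\<Sum>i\<in>{j..<N}. exp (- lam (i + 1) * t) * (real p powi (- i) - real p powi (- (i + 1))))\<bar>
    \<le> \<epsilon> + sqrt (real p powi (- N - j))"
proof -
  have pos: "real p > 0" using p by simp
  define S where "S = (\<Sum>i\<in>{j..<N}. exp (- lam (i + 1) * t) * (real p powi (- i) - real p powi (- (i + 1))))"
  define D where "D = \<bar>K x0 x0 - S\<bar>"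
  define R where "R = P t (ball_density p x0 N)"
  have cs: "contraction_semigroup M P" using P by (simp add: heat_semigroup_def)
  have R: "R \<in> L2_space M" unfolding R_def
    using t by (intro contraction_semigroupD(1)[OF cs] ball_density_L2(1)[OF p M x0]) auto
  have "L2_norm M R \<le> L2_norm M (ball_density p x0 N)" unfolding R_def
    using t by (intro contraction_semigroupD(2)[OF cs] ball_density_L2(1)[OF p M x0]) auto
  then have "(L2_norm M R)\<^sup>2 \<le> (L2_norm M (ball_density p x0 N))\<^sup>2"
    by (rule power_mono) (rule L2_norm_nonneg)
  then have R_le: "(LINT x|M. (R x)\<^sup>2) \<le> real p powi (- N)"
    by (simp add: L2_norm_sq[symmetric] ball_density_L2(4)[OF p M x0])
  have S_eq: "(\<Sum>i\<in>{j..<N}. exp (- lam (i + 1) * t) * ball_wavelet p x0 i x) = S" if "x \<in> pball p x0 j" for x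
    unfolding S_def
  proof (rule sum.cong[OF refl])
    fix i assume "i \<in> {j..<N}"
    then have "x \<in> pball p x0 i" "x \<in> pball p x0 (i + 1)"
      using that pball_mono[OF p x0, of j i] pball_mono[OF p x0, of j "i + 1"] by auto
    then show "exp (- lam (i + 1) * t) * ball_wavelet p x0 i x =
        exp (- lam (i + 1) * t) * (real p powi (- i) - real p powi (- (i + 1)))"
      by (simp add: ball_wavelet_def ball_density_apply)
  qed
  have avg: "\<bar>(LINT y|M. K x y * ball_density p x0 j y) - K x0 x0\<bar> \<le> \<epsilon>"
    if "x \<in> pball p x0 j" and int: "integrable M (\<lambda>y. K x y * ball_density p x0 j y)" for x
  proof -
    note w = ball_density_L2(2,3)[OF p M x0, of j]
    have "\<bar>(LINT y|M. K x y * ball_density p x0 j y) - K x0 x0\<bar> =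
        \<bar>LINT y|M. K x y * ball_density p x0 j y - K x0 x0 * ball_density p x0 j y\<bar>"
      using int w by simp
    also have "\<dots> \<le> (LINT y|M. \<bar>K x y * ball_density p x0 j y - K x0 x0 * ball_density p x0 j y\<bar>)"
      by (rule integral_abs_bound)
    also have "\<dots> \<le> (LINT y|M. \<epsilon> * ball_density p x0 j y)"
    proof (rule integral_mono)
      fix y
      show "\<bar>K x y * ball_density p x0 j y - K x0 x0 * ball_density p x0 j y\<bar> \<le> \<epsilon> * ball_density p x0 j y"
        using close[OF that(1), of y] pos
        by (auto simp: ball_density_apply left_diff_distrib[symmetric] abs_mult)
    qed (use int w in auto)
    also have "\<dots> = \<epsilon>" using w by simp
    finally show ?thesis .
  qed
  have ae: "AE x in M. x \<in> pball p x0 j \<longrightarrow> D \<le> \<epsilon> + \<bar>R x\<bar>"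
    using semigroup_ball_density[OF P x0 t nonneg decr lim \<open>j \<le> N\<close>] K[OF ball_density_L2(1)[OF p M x0, of j]]
  proof eventually_elim
    case (elim x)
    show ?case
    proof
      assume x: "x \<in> pball p x0 j"
      have "\<bar>(S + R x) - K x0 x0\<bar> \<le> \<epsilon>" using elim avg[OF x] S_eq[OF x] by (simp add: R_def)
      then show "D \<le> \<epsilon> + \<bar>R x\<bar>" by (simp add: D_def)
    qed
  qed
  show ?thesis
  proof (cases "D \<le> \<epsilon>")
    case True
    moreover have "0 \<le> sqrt (real p powi (- N - j))" by simp
    ultimately show ?thesis unfolding D_def S_def by linarith
  next
    case False
    have "(D - \<epsilon>)\<^sup>2 * real p powi j = (LINT x|M. (D - \<epsilon>)\<^sup>2 * indicat_real (pball p x0 j) x)"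
      using integrable_indicat_pball[OF p M x0] by simp
    also have "\<dots> \<le> (LINT x|M. (R x)\<^sup>2)"
    proof (rule integral_mono_AE)
      show "AE x in M. (D - \<epsilon>)\<^sup>2 * indicat_real (pball p x0 j) x \<le> (R x)\<^sup>2"
        using ae
      proof eventually_elim
        case (elim x)
        show ?case
        proof (cases "x \<in> pball p x0 j")
          case True
          then have "D - \<epsilon> \<le> \<bar>R x\<bar>" using elim by simp
          then have "(D - \<epsilon>)\<^sup>2 \<le> \<bar>R x\<bar>\<^sup>2" using False by (intro power_mono) auto
          then show ?thesis using True by simp
        qed simp
      qed
    qed (use integrable_indicat_pball[OF p M x0] R in \<open>auto simp: L2_space_def\<close>)
    also have "\<dots> \<le> real p powi (- N)" by (rule R_le)
    finally have "(D - \<epsilon>)\<^sup>2 \<le> real p powi (- N) / real p powi j" using pos by (simp add: field_simps)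
    also have "\<dots> = real p powi (- N - j)" using pos by (simp add: power_int_diff)
    finally have "D - \<epsilon> \<le> sqrt (real p powi (- N - j))" using False by (simp add: real_le_rsqrt)
    then show ?thesis unfolding D_def S_def by linarith
  qed
qed

text \<open>
  The intervals grow twice as fast upwards as downwards, so that the error of the previous
  lemma, \<open>p\<close> to the power \<open>- (N + j) / 2\<close> with \<open>j = - n\<close> and \<open>N = 2 n\<close>, tends to 0.
\<close>
lemma heat_kernel_diag_limit:
  assumes K: "heat_kernel p M lam K" and x0: "x0 \<in> Qp p" and t: "0 < t"
    and nonneg: "\<And>i. 0 \<le> lam i"
    and decr: "\<And>i. lam (i + 1) \<le> lam i" and lim: "\<And>k. (\<lambda>n. lam (k + int n)) \<longlonglongrightarrow> 0"
  shows "(\<lambda>n. \<Sum>i\<in>{- int n..<2 * int n}. exp (- lam (i + 1) * t) * (real p powi (- i) - real p powi (- (i + 1))))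
    \<longlonglongrightarrow> K t x0 x0"
proof -
  define S where "S n = (\<Sum>i\<in>{- int n..<2 * int n}. exp (- lam (i + 1) * t) * (real p powi (- i) - real p powi (- (i + 1))))" for n
  obtain P where P: "heat_semigroup p M lam P"
    and PK: "\<And>f. f \<in> L2_space M \<Longrightarrow>
       AE x in M. integrable M (\<lambda>y. K t x y * f y) \<and> P t f x = (LINT y|M. K t x y * f y)"
    using K t unfolding heat_kernel_def by blast
  have cont: "continuous_map (prod_topology (Qp_top p) (Qp_top p)) euclideanreal (\<lambda>(x, y). K t x y)"
    using K t unfolding heat_kernel_def by blast
  have p1: "1 < real p" using p by simp
  have "\<forall>\<^sub>F n in sequentially. dist (S n) (K t x0 x0) < \<epsilon>" if "0 < \<epsilon>" for \<epsilon>
  proof -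
    let ?W = "{z \<in> topspace (prod_topology (Qp_top p) (Qp_top p)). (\<lambda>(x, y). K t x y) z \<in> ball (K t x0 x0) (\<epsilon> / 2)}"
    have "openin (prod_topology (Qp_top p) (Qp_top p)) ?W"
      using cont by (rule openin_continuous_map_preimage) simp
    moreover have "(x0, x0) \<in> ?W" using x0 that by (simp add: topspace_Qp_top[OF p])
    ultimately obtain U V where UV: "openin (Qp_top p) U" "openin (Qp_top p) V" "x0 \<in> U" "x0 \<in> V" "U \<times> V \<subseteq> ?W"
      unfolding openin_prod_topology_alt by meson
    then obtain a b where ab: "pball p x0 a \<subseteq> U" "pball p x0 b \<subseteq> V"
      unfolding openin_Qp_top_iff[OF p] by blast
    have close: "\<bar>K t x y - K t x0 x0\<bar> \<le> \<epsilon> / 2"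
      if "x \<in> pball p x0 j" "y \<in> pball p x0 j" "j \<le> min a b" for x y j
    proof -
      have "x \<in> U" "y \<in> V" using that ab pball_mono[OF p x0, of j] by (meson min.boundedE subsetD)+
      then have "(x, y) \<in> ?W" using UV(5) by blast
      then have "\<bar>K t x0 x0 - K t x y\<bar> < \<epsilon> / 2" by (simp add: dist_real_def)
      then show ?thesis by linarith
    qed
    have bound: "\<bar>K t x0 x0 - S n\<bar> \<le> \<epsilon> / 2 + sqrt ((1 / real p) ^ n)" if "nat (- min a b) \<le> n" for n
    proof -
      have "\<bar>K t x0 x0 - S n\<bar> \<le> \<epsilon> / 2 + sqrt (real p powi (- (2 * int n) - (- int n)))"
        unfolding S_def
        by (rule heat_kernel_diag_bound[OF P x0 t nonneg decr lim PK close]) (use that in auto)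
      also have "real p powi (- (2 * int n) - (- int n)) = (1 / real p) ^ n"
        by (simp add: power_int_minus power_one_over field_simps)
      finally show ?thesis .
    qed
    have "(\<lambda>n. sqrt ((1 / real p) ^ n)) \<longlonglongrightarrow> sqrt 0"
      using p1 by (intro tendsto_intros LIMSEQ_realpow_zero) auto
    then have "\<forall>\<^sub>F n in sequentially. sqrt ((1 / real p) ^ n) < \<epsilon> / 2"
      by (rule order_tendstoD(2)) (use that in simp)
    moreover have "\<forall>\<^sub>F n in sequentially. nat (- min a b) \<le> n" by (rule eventually_ge_at_top)
    ultimately show ?thesis
    proof eventually_elim
      case (elim n)
      then show ?case using bound[of n] by (simp add: dist_real_def abs_minus_commute)
    qed
  qed
  then show ?thesis unfolding S_def[symmetric] by (rule tendstoI)
qed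

end

section \<open>The lattice sum\<close>

text \<open>
  The left hand side is largest at \<open>w = q\<close>; this is the inequality \<open>ln x \<le> x - 1\<close> at
  \<open>x = w / q\<close>.
\<close>
lemma powr_times_exp_le:
  fixes w q :: real
  assumes "0 < w" "0 < q"
  shows "w powr q * exp (- w) \<le> (q / exp 1) powr q"
proof -
  have "ln (w / q) \<le> w / q - 1" using assms by (intro ln_le_minus_one) auto
  then have "q * (ln w - ln q) \<le> q * (w / q - 1)"
    using assms by (intro mult_left_mono) (auto simp: ln_div)
  then have "q * ln w - w \<le> q * (ln q - 1)" using assms by (simp add: algebra_simps)
  then have "exp (q * ln w - w) \<le> exp (q * (ln q - 1))" by simp
  moreover have "exp (q * ln w - w) = w powr q * exp (- w)"
    using assms by (simp add: powr_def exp_diff exp_minus field_simps)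
  moreover have "exp (q * (ln q - 1)) = (q / exp 1) powr q"
    using assms by (simp add: powr_def ln_div)
  ultimately show ?thesis by simp
qed

text \<open>
  The function \<open>h\<close> of the introduction.
\<close>
definition damped :: "real \<Rightarrow> real \<Rightarrow> real" where
  "damped \<alpha> u = u * exp (- (u powr \<alpha>))"

text \<open>
  The maximum of \<open>u\<^sup>2 exp (- u\<^sup>\<alpha>)\<close>, by \<open>powr_times_exp_le\<close> with \<open>w = u\<^sup>\<alpha>\<close>.
\<close>
definition damped_const :: "real \<Rightarrow> real" where
  "damped_const \<alpha> = (2 / \<alpha> / exp 1) powr (2 / \<alpha>)"

lemma damped_const_pos: "0 < \<alpha> \<Longrightarrow> 0 < damped_const \<alpha>"
  by (simp add: damped_const_def)

lemma damped_pos: "0 < u \<Longrightarrow> 0 < damped \<alpha> u"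
  by (simp add: damped_def)

lemma damped_le_self: "0 < u \<Longrightarrow> damped \<alpha> u \<le> u"
  by (simp add: damped_def mult_left_le)

lemma damped_le_inverse:
  assumes "0 < \<alpha>" "0 < u"
  shows "damped \<alpha> u \<le> damped_const \<alpha> / u"
proof -
  have "(u powr \<alpha>) powr (2 / \<alpha>) * exp (- (u powr \<alpha>)) \<le> damped_const \<alpha>"
    unfolding damped_const_def using assms by (intro powr_times_exp_le) auto
  moreover have "(u powr \<alpha>) powr (2 / \<alpha>) = u * u"
    using assms by (simp add: powr_powr power2_eq_square)
  ultimately show ?thesis using assms by (simp add: damped_def field_simps)
qed

lemma damped_le_max:
  assumes "0 < \<alpha>" "0 < u"
  shows "damped \<alpha> u \<le> (exp 1 * \<alpha>) powr (- 1 / \<alpha>)"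
proof -
  have "(u powr \<alpha>) powr (1 / \<alpha>) * exp (- (u powr \<alpha>)) \<le> (1 / \<alpha> / exp 1) powr (1 / \<alpha>)"
    using assms by (intro powr_times_exp_le) auto
  moreover have "(1 / \<alpha> / exp 1) powr (1 / \<alpha>) = (exp 1 * \<alpha>) powr (- 1 / \<alpha>)"
  proof -
    have "1 / \<alpha> / exp 1 = inverse (exp 1 * \<alpha>)" using assms by (simp add: field_simps)
    then show ?thesis using assms by (simp add: powr_minus inverse_powr del: inverse_mult_distrib)
  qed
  ultimately show ?thesis using assms by (simp add: damped_def powr_powr)
qed

lemma damped_at_max:
  assumes "0 < \<alpha>"
  shows "damped \<alpha> (\<alpha> powr (- 1 / \<alpha>)) = (exp 1 * \<alpha>) powr (- 1 / \<alpha>)"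
proof -
  have "(\<alpha> powr (- 1 / \<alpha>)) powr \<alpha> = 1 / \<alpha>"
    unfolding powr_powr using assms by (simp add: powr_neg_one)
  moreover have "exp (- (1 / \<alpha>)) = exp 1 powr (- 1 / \<alpha>)" by (simp add: powr_def)
  ultimately show ?thesis using assms by (simp add: damped_def powr_mult)
qed

lemma has_sum_powi_neg:
  fixes r :: real
  assumes "1 < r"
  shows "((\<lambda>j::int. r powi (- j)) has_sum (1 / (r - 1))) {0<..}"
proof -
  have "((\<lambda>n. (1 / r) ^ n) has_sum ((1 / r) / (1 - 1 / r))) {1..}"
    using assms by (intro has_sum_geometric_from_1) auto
  also have "(1 / r) / (1 - 1 / r) = 1 / (r - 1)" using assms by (simp add: field_simps)
  also have "((\<lambda>n. (1 / r) ^ n) has_sum (1 / (r - 1))) {1..} \<longleftrightarrow>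
      ((\<lambda>j::int. r powi (- j)) has_sum (1 / (r - 1))) {0<..}"
    by (rule has_sum_reindex_bij_witness[of _ nat int])
      (auto simp: power_int_minus power_one_over nat_eq_iff power_int_def field_simps)
  finally show ?thesis .
qed

lemma has_sum_powi_pos:
  fixes r :: real
  assumes "1 < r"
  shows "((\<lambda>j::int. r powi j) has_sum (1 / (r - 1))) {..<0}"
proof -
  have "((\<lambda>j::int. r powi j) has_sum (1 / (r - 1))) {..<0} \<longleftrightarrow>
      ((\<lambda>j::int. r powi (- j)) has_sum (1 / (r - 1))) {0<..}"
    by (rule has_sum_reindex_bij_witness[of _ uminus uminus]) auto
  then show ?thesis using has_sum_powi_neg[OF assms] by simp
qed

definition lattice_sum :: "nat \<Rightarrow> real \<Rightarrow> real \<Rightarrow> real" where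
  "lattice_sum p \<alpha> u = (\<Sum>\<^sub>\<infinity>j\<in>UNIV. damped \<alpha> (u * real p powi j))"

context
  fixes p :: nat and \<alpha> :: real
  assumes p: "2 \<le> p" and \<alpha>: "0 < \<alpha>"
begin

lemma p_gt_1: "1 < real p" using p by simp

text \<open>
  The terms of index 0 and 1 are kept. Those of negative index are bounded by \<open>u p\<^sup>j\<close> and those
  of index at least 2 by a multiple of \<open>1 / (u p\<^sup>j)\<close>, which leaves two geometric series.
\<close>
lemma lattice_sum_bound:
  assumes u: "0 < u"
  shows "(\<lambda>j::int. damped \<alpha> (u * real p powi j)) summable_on UNIV"
    and "lattice_sum p \<alpha> u \<le> u / (real p - 1) + damped \<alpha> u + damped \<alpha> (u * p) +
       damped_const \<alpha> / (u * p * (real p - 1))"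
proof -
  let ?f = "\<lambda>j::int. damped \<alpha> (u * real p powi j)"
  define g where "g j = (if j < 0 then u * real p powi j else if j \<le> 1 then ?f j
      else damped_const \<alpha> / (u * p) * real p powi (- (j - 1)))" for j :: int
  have "((\<lambda>j::int. real p powi (- (j - 1))) has_sum (1 / (real p - 1))) {1<..} \<longleftrightarrow>
      ((\<lambda>j::int. real p powi (- j)) has_sum (1 / (real p - 1))) {0<..}"
    by (rule has_sum_reindex_bij_witness[of _ "\<lambda>j. j + 1" "\<lambda>j. j - 1"]) auto
  then have "((\<lambda>j::int. damped_const \<alpha> / (u * p) * real p powi (- (j - 1))) has_sum
      (damped_const \<alpha> / (u * p) * (1 / (real p - 1)))) {1<..}"
    using has_sum_powi_neg[OF p_gt_1] by (intro has_sum_cmult_right) simp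
  then have g1: "(g has_sum (damped_const \<alpha> / (u * p) * (1 / (real p - 1)))) {1<..}"
    by (rule has_sum_cong[THEN iffD1, rotated]) (simp add: g_def)
  have "((\<lambda>j::int. u * real p powi j) has_sum (u * (1 / (real p - 1)))) {..<0}"
    by (intro has_sum_cmult_right has_sum_powi_pos p_gt_1)
  then have g2: "(g has_sum (u * (1 / (real p - 1)))) {..<0}"
    by (rule has_sum_cong[THEN iffD1, rotated]) (simp add: g_def)
  have g3: "(g has_sum (damped \<alpha> u + damped \<alpha> (u * p))) {0, 1}"
    by (rule has_sum_finiteI) (auto simp: g_def)
  have "{..<0} \<union> {0, 1} \<union> {1<..} = (UNIV :: int set)" "({..<0} \<union> {0, 1}) \<inter> {1<..} = ({} :: int set)"
    "{..<0} \<inter> {0, 1} = ({} :: int set)" by auto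
  then have g: "(g has_sum (u * (1 / (real p - 1)) + (damped \<alpha> u + damped \<alpha> (u * p)) +
      damped_const \<alpha> / (u * p) * (1 / (real p - 1)))) UNIV"
    using has_sum_Un_disjoint[OF has_sum_Un_disjoint[OF g2 g3] g1] by simp
  have pos: "0 < u * real p powi j" for j :: int using u p by simp
  have le: "?f j \<le> g j" for j
  proof -
    have "?f j \<le> u * real p powi j" by (rule damped_le_self[OF pos])
    moreover have "?f j \<le> damped_const \<alpha> / (u * real p powi j)"
      by (rule damped_le_inverse[OF \<alpha> pos])
    moreover have "damped_const \<alpha> / (u * real p powi j) = damped_const \<alpha> / (u * p) * real p powi (- (j - 1))"
      using p u by (simp add: power_int_diff power_int_minus field_simps)
    ultimately show ?thesis by (simp add: g_def)
  qed
  have nonneg: "0 \<le> ?f j" for j by (rule less_imp_le[OF damped_pos[OF pos]])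
  show summ: "?f summable_on UNIV"
    by (rule summable_on_comparison_test[OF has_sum_imp_summable[OF g] le nonneg])
  have "lattice_sum p \<alpha> u \<le> u * (1 / (real p - 1)) + (damped \<alpha> u + damped \<alpha> (u * p)) +
      damped_const \<alpha> / (u * p) * (1 / (real p - 1))"
    unfolding lattice_sum_def by (rule has_sum_mono[OF has_sum_infsum[OF summ] g le])
  then show "lattice_sum p \<alpha> u \<le> u / (real p - 1) + damped \<alpha> u + damped \<alpha> (u * p) +
       damped_const \<alpha> / (u * p * (real p - 1))"
    by (simp add: add_ac)
qed

lemma lattice_sum_ge:
  assumes u: "0 < u"
  shows "damped \<alpha> (u * real p powi j) \<le> lattice_sum p \<alpha> u"
proof -
  have "(\<Sum>i\<in>{j}. damped \<alpha> (u * real p powi i)) \<le> lattice_sum p \<alpha> u"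
    unfolding lattice_sum_def using lattice_sum_bound(1)[OF u] u p
    by (intro finite_sum_le_infsum) (auto intro!: less_imp_le damped_pos)
  then show ?thesis by simp
qed

lemma lattice_sum_pos: "0 < u \<Longrightarrow> 0 < lattice_sum p \<alpha> u"
  using lattice_sum_ge[of u 0] damped_pos[of u \<alpha>] by simp

lemma lattice_sum_shift: "lattice_sum p \<alpha> (u * real p powi k) = lattice_sum p \<alpha> u"
  unfolding lattice_sum_def using p
  by (intro infsum_reindex_bij_witness[of _ "\<lambda>j. j - k" "\<lambda>j. j + k"]) (auto simp: power_int_add field_simps)

text \<open>
  Folding the two-sided series into a one-sided one makes the Weierstrass test and dominated
  convergence along partial sums available.
\<close>
lemma lattice_sum_sums:
  assumes u: "0 < u"
  shows "(\<lambda>n. damped \<alpha> (u * real p ^ n) + damped \<alpha> (u / real p ^ Suc n)) sums lattice_sum p \<alpha> u"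
proof -
  let ?f = "\<lambda>j::int. damped \<alpha> (u * real p powi j)"
  note summ = lattice_sum_bound(1)[OF u]
  define a b where "a = infsum ?f {0..}" and "b = infsum ?f {..<0}"
  have a: "(?f has_sum a) {0..}" and b: "(?f has_sum b) {..<0}"
    unfolding a_def b_def by (auto intro!: has_sum_infsum summable_on_subset[OF summ])
  have "{0..} \<union> {..<0} = (UNIV :: int set)" "{0..} \<inter> {..<0} = ({} :: int set)" by auto
  then have ab: "lattice_sum p \<alpha> u = a + b"
    unfolding lattice_sum_def using has_sum_Un_disjoint[OF a b] by (simp add: infsumI)
  have "((\<lambda>n. damped \<alpha> (u * real p ^ n)) has_sum a) UNIV \<longleftrightarrow> (?f has_sum a) {0..}"
    by (rule has_sum_reindex_bij_witness[of _ nat int]) (auto simp: power_int_def)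
  moreover have "((\<lambda>n. damped \<alpha> (u / real p ^ Suc n)) has_sum b) UNIV \<longleftrightarrow> (?f has_sum b) {..<0}"
    by (rule has_sum_reindex_bij_witness[of _ "\<lambda>j. nat (- j - 1)" "\<lambda>n. - int (Suc n)"])
      (auto simp: power_int_def nat_add_distrib field_simps simp flip: power_Suc)
  ultimately show ?thesis
    unfolding ab using a b by (intro sums_add has_sum_imp_sums) auto
qed

lemma lattice_sum_uniform_limit:
  assumes a: "0 < a"
  shows "uniform_limit {a..b}
    (\<lambda>N u. \<Sum>n<N. damped \<alpha> (u * real p ^ n) + damped \<alpha> (u / real p ^ Suc n)) (lattice_sum p \<alpha>) sequentially"
proof -
  \<comment> \<open>The two summands majorise the terms of non-negative and of negative index.\<close>
  define M where "M n = (damped_const \<alpha> / a + \<bar>b\<bar>) * (1 / real p) ^ n" for n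
  have "uniform_limit {a..b}
    (\<lambda>N u. \<Sum>n<N. damped \<alpha> (u * real p ^ n) + damped \<alpha> (u / real p ^ Suc n))
    (\<lambda>u. \<Sum>n. damped \<alpha> (u * real p ^ n) + damped \<alpha> (u / real p ^ Suc n)) sequentially"
  proof (rule Weierstrass_m_test)
    show "summable M" unfolding M_def using p_gt_1 by (intro summable_mult summable_geometric) simp
    fix n u assume "u \<in> {a..b}"
    then have u: "a \<le> u" "u \<le> b" "0 < u" using a by auto
    have pn: "1 \<le> real p" "1 \<le> real p ^ n" using p_gt_1 by simp_all
    have "damped \<alpha> (u * real p ^ n) \<le> damped_const \<alpha> / (u * real p ^ n)"
      using u pn by (intro damped_le_inverse \<alpha>) auto
    also have "\<dots> \<le> damped_const \<alpha> / (a * real p ^ n)"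
      using u a pn damped_const_pos[OF \<alpha>] by (intro divide_left_mono mult_right_mono) auto
    also have "\<dots> = damped_const \<alpha> / a * (1 / real p) ^ n" by (simp add: power_one_over field_simps)
    finally have 1: "damped \<alpha> (u * real p ^ n) \<le> damped_const \<alpha> / a * (1 / real p) ^ n" .
    have "damped \<alpha> (u / real p ^ Suc n) \<le> u / real p ^ Suc n"
      using u pn by (intro damped_le_self) auto
    also have "\<dots> \<le> \<bar>b\<bar> / real p ^ n"
      using u pn by (intro frac_le) (auto simp: mult_le_cancel_right1)
    also have "\<dots> = \<bar>b\<bar> * (1 / real p) ^ n" by (simp add: power_one_over field_simps)
    finally have 2: "damped \<alpha> (u / real p ^ Suc n) \<le> \<bar>b\<bar> * (1 / real p) ^ n" .
    have "0 \<le> damped \<alpha> (u * real p ^ n)" "0 \<le> damped \<alpha> (u / real p ^ Suc n)"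
      using u pn by (auto intro!: less_imp_le damped_pos)
    then show "norm (damped \<alpha> (u * real p ^ n) + damped \<alpha> (u / real p ^ Suc n)) \<le> M n"
      using 1 2 by (simp add: M_def distrib_right)
  qed
  then show ?thesis
    by (rule uniform_limit_cong'[THEN iffD1, rotated 2]) (use a lattice_sum_sums in \<open>auto simp: sums_iff\<close>)
qed

lemma continuous_on_lattice_sum: "continuous_on {0<..} (lattice_sum p \<alpha>)"
proof -
  have "continuous_on {a..b} (lattice_sum p \<alpha>)" if "0 < a" for a b
  proof (rule uniform_limit_theorem[OF _ lattice_sum_uniform_limit[OF that, of b]])
    show "\<forall>\<^sub>F N in sequentially. continuous_on {a..b}
        (\<lambda>u. \<Sum>n<N. damped \<alpha> (u * real p ^ n) + damped \<alpha> (u / real p ^ Suc n))"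
      unfolding damped_def using that p \<alpha>
      by (intro always_eventually allI continuous_intros) (auto intro!: mult_pos_pos divide_pos_pos)
  qed auto
  then have "isCont (lattice_sum p \<alpha>) u" if "0 < u" for u
    using that by (intro continuous_on_interior[of "{u / 2..2 * u}"]) auto
  then show ?thesis by (auto intro!: continuous_at_imp_continuous_on)
qed

end

section \<open>The lattice sum is not constant\<close>

lemma complex_powr_real_eq_exp: "0 < x \<Longrightarrow> complex_of_real x powr w = exp (w * of_real (ln x))"
  by (simp add: powr_def Ln_of_real)

text \<open>
  The substitution \<open>y = m x\<close> in the Gamma integrand. If \<open>m\<close> to the power \<open>\<i> \<theta>\<close> is 1, then
  the oscillating factor does not notice the dilation and only the damped factor is shifted.
\<close>
lemma mellin_dilation:
  fixes \<alpha> \<theta> m b :: real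
  assumes \<alpha>: "0 < \<alpha>" and m: "0 < m" and b: "1 < b"
    and period: "exp (\<i> * of_real \<theta> * of_real (ln m)) = 1"
  shows "((\<lambda>x. of_real x powr (\<i> * of_real \<theta> - 1) * of_real (damped \<alpha> (x powr (1 / \<alpha>) * m powr (1 / \<alpha>))))
    has_integral integral {m..m * b} (\<lambda>y. of_real y powr (Complex (1 / \<alpha>) \<theta> - 1) / of_real (exp y))) {1..b}"
proof -
  define \<phi> where "\<phi> y = complex_of_real y powr (Complex (1 / \<alpha>) \<theta> - 1) / of_real (exp y)" for y
  have "continuous_on {m..m * b} \<phi>"
    unfolding \<phi>_def using m by (intro continuous_intros) (auto simp: complex_nonpos_Reals_iff)
  then have "(\<phi> has_integral integral {m..m * b} \<phi>) {m..m * b}"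
    by (intro integrable_integral integrable_continuous_real)
  then have "((\<lambda>x. \<phi> (m * x)) has_integral (1 / \<bar>m\<bar>) *\<^sub>R integral {m..m * b} \<phi>) ((\<lambda>x. x / m) ` {m..m * b})"
    using m by (intro has_integral_stretch_real) auto
  moreover have "(\<lambda>x. x / m) ` {m..m * b} = {1..b}"
    using m by (auto simp: field_simps intro!: image_eqI[where x = "m * _"])
  ultimately have "((\<lambda>x. of_real m * \<phi> (m * x)) has_integral of_real m * ((1 / \<bar>m\<bar>) *\<^sub>R integral {m..m * b} \<phi>)) {1..b}"
    by (intro has_integral_mult_right) simp
  moreover have "of_real m * ((1 / \<bar>m\<bar>) *\<^sub>R integral {m..m * b} \<phi>) = integral {m..m * b} \<phi>"
    using m by (simp add: scaleR_conv_of_real)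
  ultimately have "((\<lambda>x. of_real m * \<phi> (m * x)) has_integral integral {m..m * b} \<phi>) {1..b}" by simp
  then show ?thesis
    unfolding \<phi>_def[symmetric]
  proof (rule has_integral_eq[rotated])
    fix x assume "x \<in> {1..b}"
    then have x: "0 < x" by simp
    have z: "Complex (1 / \<alpha>) \<theta> = of_real (1 / \<alpha>) + \<i> * of_real \<theta>" by (simp add: complex_eq_iff)
    have "complex_of_real (m * x) powr (Complex (1 / \<alpha>) \<theta> - 1) =
        exp ((of_real (1 / \<alpha>) + \<i> * of_real \<theta> - 1) * (of_real (ln m) + of_real (ln x)))"
      using m x by (subst complex_powr_real_eq_exp) (simp_all add: z ln_mult)
    also have "\<dots> = exp (of_real (1 / \<alpha> * (ln m + ln x))) * exp (\<i> * of_real \<theta> * of_real (ln m)) *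
        exp (of_real (- ln m)) * exp ((\<i> * of_real \<theta> - 1) * of_real (ln x))"
      by (simp add: exp_add[symmetric] algebra_simps)
    also have "exp (of_real (1 / \<alpha> * (ln m + ln x))) = complex_of_real (x powr (1 / \<alpha>) * m powr (1 / \<alpha>))"
      using m x by (simp add: powr_def exp_add[symmetric] exp_of_real[symmetric] algebra_simps
          flip: of_real_mult)
    also have "exp (of_real (- ln m)) = complex_of_real (1 / m)"
      using m by (simp only: exp_of_real exp_minus exp_ln inverse_eq_divide)
    finally have *: "complex_of_real (m * x) powr (Complex (1 / \<alpha>) \<theta> - 1) =
        of_real (x powr (1 / \<alpha>) * m powr (1 / \<alpha>)) * of_real (1 / m) * of_real x powr (\<i> * of_real \<theta> - 1)"
      using x by (simp only: period mult_1_right complex_powr_real_eq_exp)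
    have "(x powr (1 / \<alpha>) * m powr (1 / \<alpha>)) powr \<alpha> = m * x"
      using m x \<alpha> by (simp add: powr_mult powr_powr)
    then have d: "damped \<alpha> (x powr (1 / \<alpha>) * m powr (1 / \<alpha>)) = x powr (1 / \<alpha>) * m powr (1 / \<alpha>) / exp (m * x)"
      by (simp add: damped_def exp_minus field_simps)
    show "of_real m * \<phi> (m * x) =
        of_real x powr (\<i> * of_real \<theta> - 1) * of_real (damped \<alpha> (x powr (1 / \<alpha>) * m powr (1 / \<alpha>)))"
      unfolding d \<phi>_def * using m by simp
  qed
qed

lemma telescoping_integral:
  fixes f :: "real \<Rightarrow> complex" and b :: real
  assumes b: "1 < b" and cont: "continuous_on {0<..} f"
  shows "(\<Sum>n<N. integral {b ^ n..b ^ n * b} f + integral {1 / b ^ Suc n..1 / b ^ Suc n * b} f) =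
    integral {1 / b ^ N..b ^ N} f"
proof (induction N)
  case 0
  then show ?case by simp
next
  case (Suc N)
  have int: "f integrable_on {c..d}" if "0 < c" for c d
    using that by (intro integrable_continuous_real continuous_on_subset[OF cont]) auto
  have bN: "1 \<le> b ^ N" using b by simp
  have le: "1 / b ^ Suc N \<le> 1 / b ^ N" "1 / b ^ N \<le> b ^ N" "b ^ N \<le> b ^ N * b"
    using b bN by (auto simp: field_simps intro: order_trans[of _ 1] mult_mono[of 1 "b ^ N" 1 "b ^ N", simplified])
  have le4: "1 / b ^ N \<le> b ^ Suc N" using order_trans[OF le(2,3)] by (simp add: mult.commute)
  have pos: "0 < 1 / b ^ Suc N" "0 < 1 / b ^ N" using b by simp_all
  have "integral {1 / b ^ Suc N..b ^ Suc N} f =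
      integral {1 / b ^ Suc N..1 / b ^ N} f + integral {1 / b ^ N..b ^ Suc N} f"
    using le le4 pos by (intro Henstock_Kurzweil_Integration.integral_combine[symmetric] int) (auto simp: mult.commute)
  also have "integral {1 / b ^ N..b ^ Suc N} f =
      integral {1 / b ^ N..b ^ N} f + integral {b ^ N..b ^ Suc N} f"
    using le le4 pos by (intro Henstock_Kurzweil_Integration.integral_combine[symmetric] int) (auto simp: mult.commute)
  finally show ?case using Suc b by (simp add: field_simps)
qed

lemma Gamma_integral_limit:
  assumes z: "0 < Re z" and b: "1 < b"
  shows "(\<lambda>N. integral {1 / b ^ N..b ^ N} (\<lambda>t. of_real t powr (z - 1) / of_real (exp t))) \<longlonglongrightarrow> Gamma z"
proof -
  define \<phi> where "\<phi> t = complex_of_real t powr (z - 1) / of_real (exp t)" for t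
  define f where "f N t = (if t \<in> {1 / b ^ N..b ^ N} then \<phi> t else 0)" for N t
  have abs: "\<phi> absolutely_integrable_on {0<..}"
    unfolding \<phi>_def by (rule absolutely_integrable_Gamma_integral'[OF z])
  have sub: "{1 / b ^ N..b ^ N} \<subseteq> {0<..}" for N
    using b by (auto intro: less_le_trans[of 0 "1 / b ^ N"])
  have eq: "integral {0<..} (f N) = integral {1 / b ^ N..b ^ N} \<phi>" for N
    unfolding f_def integral_restrict_Int using sub[of N] by (simp add: Int_absorb2)
  have "(\<lambda>N. integral {0<..} (f N)) \<longlonglongrightarrow> integral {0<..} \<phi>"
  proof (rule dominated_convergence)
    show "(\<lambda>t. norm (\<phi> t)) integrable_on {0<..}"
      using abs by (simp add: absolutely_integrable_on_def)
    fix N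
    have "continuous_on {0<..} \<phi>"
      unfolding \<phi>_def by (intro continuous_intros) (auto simp: complex_nonpos_Reals_iff)
    then have "continuous_on {1 / b ^ N..b ^ N} \<phi>" using sub by (rule continuous_on_subset)
    then show "f N integrable_on {0<..}"
      unfolding f_def using sub by (subst integrable_restrict_Int) (auto intro!: integrable_continuous_real simp: Int_absorb2)
    show "\<And>t. t \<in> {0<..} \<Longrightarrow> norm (f N t) \<le> norm (\<phi> t)" by (simp add: f_def)
  next
    fix t :: real assume "t \<in> {0<..}"
    then have t: "0 < t" by simp
    obtain n1 where n1: "t < b ^ n1" using real_arch_pow[OF b] by blast
    obtain n2 where n2: "1 / t < b ^ n2" using real_arch_pow[OF b] by blast
    have "f N t = \<phi> t" if "max n1 n2 \<le> N" for N
    proof -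
      have "b ^ n1 \<le> b ^ N" "b ^ n2 \<le> b ^ N" using that b by (auto intro: power_increasing)
      then have "t \<le> b ^ N" "1 / t \<le> b ^ N" using n1 n2 by auto
      then show ?thesis using t b by (simp add: f_def field_simps)
    qed
    then show "(\<lambda>N. f N t) \<longlonglongrightarrow> \<phi> t"
      by (intro tendsto_eventually eventually_sequentiallyI)
  qed
  moreover have "integral {0<..} \<phi> = Gamma z"
    using Gamma_integral_complex'[OF z] unfolding \<phi>_def by (rule integral_unique)
  ultimately show ?thesis unfolding eq by (simp add: \<phi>_def[abs_def])
qed

text \<open>
  With \<open>b = p\<^sup>\<alpha>\<close> and \<open>\<theta> = 2 \<pi> / ln b\<close>, the integrals over \<open>[1, b]\<close> of the terms of the
  lattice sum, taken in the variable \<open>x = u\<^sup>\<alpha>\<close> against \<open>x\<close> to the power \<open>\<i> \<theta> - 1\<close>, are the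
  integrals of the Gamma integrand over consecutive intervals that tile the half-line. A constant
  lattice sum would make their total 0, since \<open>x\<close> to the power \<open>\<i> \<theta>\<close> takes the same value at 1 and
  at \<open>b\<close>.
\<close>
lemma lattice_sum_not_constant:
  assumes p: "2 \<le> p" and \<alpha>: "0 < \<alpha>" and const: "\<And>u. 0 < u \<Longrightarrow> lattice_sum p \<alpha> u = c"
  shows False
proof -
  have p1: "1 < real p" using p by simp
  define b where "b = real p powr \<alpha>"
  have b: "1 < b" unfolding b_def using p1 \<alpha> by simp
  define \<theta> where "\<theta> = 2 * pi / ln b"
  have lnb: "0 < ln b" using b by simp
  then have \<theta>: "\<theta> \<noteq> 0" "\<theta> * ln b = 2 * pi" by (simp_all add: \<theta>_def)
  define z where "z = Complex (1 / \<alpha>) \<theta>"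
  define \<phi> where "\<phi> y = complex_of_real y powr (z - 1) / of_real (exp y)" for y
  define e where "e x = complex_of_real x powr (\<i> * of_real \<theta> - 1)" for x
  have cont_\<phi>: "continuous_on {0<..} \<phi>"
    unfolding \<phi>_def by (intro continuous_intros) (auto simp: complex_nonpos_Reals_iff)
  have cont_e: "continuous_on {1..b} e"
    unfolding e_def by (intro continuous_intros) (auto simp: complex_nonpos_Reals_iff)
  have period: "exp (\<i> * of_real \<theta> * of_real (ln m)) = 1" if "ln m = of_int k * ln b" for m and k :: int
  proof -
    have "\<theta> * ln m = 2 * of_int k * pi" using that \<theta>(2) by (simp add: algebra_simps)
    then have "\<i> * of_real \<theta> * of_real (ln m) = complex_of_real (2 * of_int k * pi) * \<i>"
      by (metis of_real_mult mult.commute mult.assoc)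
    also have "exp \<dots> = 1"
      using exp_integer_2pi[of "of_int k"] by simp
    finally show ?thesis .
  qed
  have bpow: "(b ^ n) powr (1 / \<alpha>) = real p ^ n" for n
    using \<alpha> p1 by (simp add: b_def powr_powr powr_realpow[symmetric] mult.commute)
  define T where "T N u = (\<Sum>n<N. damped \<alpha> (u * real p ^ n) + damped \<alpha> (u / real p ^ Suc n))" for N u
  define f where "f N x = e x * of_real (T N (x powr (1 / \<alpha>)))" for N x
  have f_int: "(f N has_integral integral {1 / b ^ N..b ^ N} \<phi>) {1..b}" for N
  proof -
    have "((\<lambda>x. e x * of_real (damped \<alpha> (x powr (1 / \<alpha>) * real p ^ n)) +
        e x * of_real (damped \<alpha> (x powr (1 / \<alpha>) / real p ^ Suc n))) has_integral
        (integral {b ^ n..b ^ n * b} \<phi> + integral {1 / b ^ Suc n..1 / b ^ Suc n * b} \<phi>)) {1..b}" for n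
    proof (rule has_integral_add)
      have "ln (b ^ n) = of_int (int n) * ln b" using b by (simp add: ln_realpow)
      from mellin_dilation[OF \<alpha> _ b period[OF this]] b
      show "((\<lambda>x. e x * of_real (damped \<alpha> (x powr (1 / \<alpha>) * real p ^ n))) has_integral
          integral {b ^ n..b ^ n * b} \<phi>) {1..b}"
        by (simp add: bpow e_def \<phi>_def[abs_def] z_def)
      have "ln (1 / b ^ Suc n) = of_int (- int (Suc n)) * ln b" using b by (simp add: ln_div ln_realpow algebra_simps del: power_Suc)
      from mellin_dilation[OF \<alpha> _ b period[OF this]] b
      have "((\<lambda>x. e x * of_real (damped \<alpha> (x powr (1 / \<alpha>) * (1 / b ^ Suc n) powr (1 / \<alpha>)))) has_integral
          integral {1 / b ^ Suc n..1 / b ^ Suc n * b} \<phi>) {1..b}"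
        by (simp add: e_def \<phi>_def[abs_def] z_def)
      moreover have "(1 / b ^ Suc n) powr (1 / \<alpha>) = 1 / real p ^ Suc n"
        using b by (simp add: powr_divide bpow del: power_Suc)
      ultimately show "((\<lambda>x. e x * of_real (damped \<alpha> (x powr (1 / \<alpha>) / real p ^ Suc n))) has_integral
          integral {1 / b ^ Suc n..1 / b ^ Suc n * b} \<phi>) {1..b}"
        by (simp del: power_Suc)
    qed
    then have "((\<lambda>x. \<Sum>n<N. e x * of_real (damped \<alpha> (x powr (1 / \<alpha>) * real p ^ n)) +
        e x * of_real (damped \<alpha> (x powr (1 / \<alpha>) / real p ^ Suc n))) has_integral
        (\<Sum>n<N. integral {b ^ n..b ^ n * b} \<phi> + integral {1 / b ^ Suc n..1 / b ^ Suc n * b} \<phi>)) {1..b}"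
      by (intro has_integral_sum) auto
    then show ?thesis
      unfolding telescoping_integral[OF b cont_\<phi>] f_def T_def
      by (simp add: sum_distrib_left distrib_left)
  qed
  have T_sums: "(\<lambda>N. T N (x powr (1 / \<alpha>))) \<longlonglongrightarrow> c" and T_bounds: "0 \<le> T N (x powr (1 / \<alpha>))" "T N (x powr (1 / \<alpha>)) \<le> c"
    if "x \<in> {1..b}" for x N
  proof -
    define u where "u = x powr (1 / \<alpha>)"
    have u: "0 < u" using that by (simp add: u_def)
    have s: "(\<lambda>n. damped \<alpha> (u * real p ^ n) + damped \<alpha> (u / real p ^ Suc n)) sums c"
      using lattice_sum_sums[OF p \<alpha> u] const[OF u] by simp
    have nn: "0 \<le> damped \<alpha> (u * real p ^ n) + damped \<alpha> (u / real p ^ Suc n)" for n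
      using u p1 by (intro add_nonneg_nonneg less_imp_le[OF damped_pos]) auto
    show "(\<lambda>N. T N (x powr (1 / \<alpha>))) \<longlonglongrightarrow> c"
      using s by (simp add: sums_def T_def u_def)
    show "0 \<le> T N (x powr (1 / \<alpha>))" unfolding T_def u_def[symmetric] by (intro sum_nonneg nn)
    show "T N (x powr (1 / \<alpha>)) \<le> c"
      unfolding T_def u_def[symmetric] sums_unique[OF s]
      by (intro sum_le_suminf sums_summable[OF s]) (simp_all add: nn del: power_Suc)
  qed
  have "(\<lambda>N. integral {1..b} (f N)) \<longlonglongrightarrow> integral {1..b} (\<lambda>x. e x * of_real c)"
  proof (rule dominated_convergence)
    show "f N integrable_on {1..b}" for N using f_int by blast
    show "(\<lambda>x. norm (e x) * c) integrable_on {1..b}"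
      by (intro integrable_continuous_real continuous_intros cont_e)
    show "norm (f N x) \<le> norm (e x) * c" if "x \<in> {1..b}" for N x
      using T_bounds[OF that, of N] by (auto simp: f_def norm_mult intro!: mult_left_mono)
    show "(\<lambda>N. f N x) \<longlonglongrightarrow> e x * of_real c" if "x \<in> {1..b}" for x
      unfolding f_def by (intro tendsto_intros T_sums that)
  qed
  moreover have "integral {1..b} (f N) = integral {1 / b ^ N..b ^ N} \<phi>" for N
    by (rule integral_unique[OF f_int])
  moreover have "(\<lambda>N. integral {1 / b ^ N..b ^ N} \<phi>) \<longlonglongrightarrow> Gamma z"
    unfolding \<phi>_def using \<alpha> b by (intro Gamma_integral_limit) (auto simp: z_def)
  ultimately have "integral {1..b} (\<lambda>x. e x * of_real c) = Gamma z"
    using LIMSEQ_unique by auto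
  moreover have "integral {1..b} (\<lambda>x. e x * of_real c) = 0"
  proof -
    have "(e has_integral (complex_of_real b powr (\<i> * of_real \<theta>) / (\<i> * of_real \<theta>) -
        complex_of_real 1 powr (\<i> * of_real \<theta>) / (\<i> * of_real \<theta>))) {1..b}"
    proof (rule fundamental_theorem_of_calculus)
      show "1 \<le> b" using b by simp
      fix x assume "x \<in> {1..b}"
      then have x: "0 < x" by simp
      have "((\<lambda>w. w powr (\<i> * of_real \<theta>) / (\<i> * of_real \<theta>)) has_field_derivative
          (\<i> * of_real \<theta> * of_real x powr (\<i> * of_real \<theta> - 1)) / (\<i> * of_real \<theta>)) (at (complex_of_real x))"
        using x by (intro DERIV_cdivide has_field_derivative_powr) (auto simp: complex_nonpos_Reals_iff)
      then have "((\<lambda>w. w powr (\<i> * of_real \<theta>) / (\<i> * of_real \<theta>)) has_field_derivative e x) (at (complex_of_real x))"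
        using \<theta> by (simp add: e_def)
      then show "((\<lambda>x. complex_of_real x powr (\<i> * of_real \<theta>) / (\<i> * of_real \<theta>)) has_vector_derivative e x)
          (at x within {1..b})"
        by (rule has_vector_derivative_real_field)
    qed
    moreover have "complex_of_real b powr (\<i> * of_real \<theta>) = 1"
      using period[of b 1] b by (simp add: complex_powr_real_eq_exp)
    ultimately have "(e has_integral 0) {1..b}" by simp
    then have "((\<lambda>x. e x * of_real c) has_integral 0 * of_real c) {1..b}" by (rule has_integral_mult_left)
    then have "((\<lambda>x. e x * of_real c) has_integral 0) {1..b}" by (simp only: mult_zero_left)
    then show ?thesis by (rule integral_unique)
  qed
  moreover have "Gamma z \<noteq> 0"
  proof (rule Gamma_nonzero)
    have "0 < Re z" using \<alpha> by (simp add: z_def)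
    then show "z \<notin> \<int>\<^sub>\<le>\<^sub>0" by (auto elim!: nonpos_Ints_cases)
  qed
  ultimately show False by simp
qed

section \<open>Extreme values of the profile\<close>

text \<open>
  The function \<open>A\<close> of the theorem.
\<close>
definition heat_profile :: "real \<Rightarrow> nat \<Rightarrow> real \<Rightarrow> real" where
  "heat_profile \<alpha> p s = (1 - 1 / real p) * lattice_sum p \<alpha> (real p powr (s / \<alpha>))"

context
  fixes p :: nat and \<alpha> :: real
  assumes p: "2 \<le> p" and \<alpha>: "0 < \<alpha>"
begin

lemma fundamental_domain:
  assumes "0 < a" "0 < u"
  shows "\<exists>j. a \<le> u * real p powi j \<and> u * real p powi j < a * real p"
proof -
  have p1: "1 < real p" using p by simp
  define j where "j = \<lfloor>log (real p) (u / a)\<rfloor>"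
  have "real p powr (of_int j) \<le> u / a" "u / a < real p powr (of_int j + 1)"
    using assms p1 unfolding j_def
    by (simp_all add: le_log_iff[symmetric] log_less_iff[symmetric])
  then have "real p powi j \<le> u / a" "u / a < real p powi j * real p"
    using p1 by (simp_all add: powr_add powr_real_of_int')
  then have "a \<le> u * real p powi (- j)" "u * real p powi (- j) < a * real p"
    using assms p1 by (simp_all add: power_int_minus field_simps)
  then show ?thesis by blast
qed

lemma range_heat_profile: "range (heat_profile \<alpha> p) = (\<lambda>u. (1 - 1 / real p) * lattice_sum p \<alpha> u) ` {0<..}"
proof -
  have p1: "1 < real p" using p by simp
  have "real p powr (\<alpha> * log (real p) u / \<alpha>) = u" if "0 < u" for u
    using that p1 \<alpha> by simp
  then have "u \<in> range (\<lambda>s. real p powr (s / \<alpha>))" if "0 < u" for u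
    using that by (intro range_eqI[of _ _ "\<alpha> * log (real p) u"]) simp
  then have "{0<..} \<subseteq> range (\<lambda>s. real p powr (s / \<alpha>))" by auto
  moreover have "range (\<lambda>s. real p powr (s / \<alpha>)) \<subseteq> {0<..}" using p1 by auto
  ultimately have "range (\<lambda>s. real p powr (s / \<alpha>)) = {0<..}" by blast
  moreover have "heat_profile \<alpha> p = (\<lambda>u. (1 - 1 / real p) * lattice_sum p \<alpha> u) \<circ> (\<lambda>s. real p powr (s / \<alpha>))"
    by (simp add: fun_eq_iff heat_profile_def)
  ultimately show ?thesis by (simp only: image_comp[symmetric])
qed

lemma lattice_sum_attains_bounds:
  "\<exists>v>0. \<forall>u>0. lattice_sum p \<alpha> v \<le> lattice_sum p \<alpha> u"
  "\<exists>v>0. \<forall>u>0. lattice_sum p \<alpha> u \<le> lattice_sum p \<alpha> v"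
proof -
  have p1: "1 < real p" using p by simp
  have cont: "continuous_on {1..real p} (lattice_sum p \<alpha>)"
    by (rule continuous_on_subset[OF continuous_on_lattice_sum[OF p \<alpha>]]) auto
  have ne: "{1..real p} \<noteq> {}" using p1 by simp
  have red: "\<exists>w\<in>{1..real p}. lattice_sum p \<alpha> u = lattice_sum p \<alpha> w" if "0 < u" for u
  proof -
    obtain j where "1 \<le> u * real p powi j" "u * real p powi j < 1 * real p"
      using fundamental_domain[of 1 u] \<open>0 < u\<close> by auto
    then show ?thesis
      by (intro bexI[of _ "u * real p powi j"]) (auto simp: lattice_sum_shift[OF p \<alpha>])
  qed
  obtain v where "v \<in> {1..real p}" "\<forall>w\<in>{1..real p}. lattice_sum p \<alpha> v \<le> lattice_sum p \<alpha> w"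
    using continuous_attains_inf[OF compact_Icc ne cont] by blast
  then show "\<exists>v>0. \<forall>u>0. lattice_sum p \<alpha> v \<le> lattice_sum p \<alpha> u"
    using red by (intro exI[of _ v]) force
  obtain v where "v \<in> {1..real p}" "\<forall>w\<in>{1..real p}. lattice_sum p \<alpha> w \<le> lattice_sum p \<alpha> v"
    using continuous_attains_sup[OF compact_Icc ne cont] by blast
  then show "\<exists>v>0. \<forall>u>0. lattice_sum p \<alpha> u \<le> lattice_sum p \<alpha> v"
    using red by (intro exI[of _ v]) force
qed

lemma Least_heat_profile:
  shows "0 < u \<Longrightarrow> (LEAST y. y \<in> range (heat_profile \<alpha> p)) \<le> (1 - 1 / real p) * lattice_sum p \<alpha> u"
    and "(\<And>u. 0 < u \<Longrightarrow> c \<le> (1 - 1 / real p) * lattice_sum p \<alpha> u) \<Longrightarrow>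
      c \<le> (LEAST y. y \<in> range (heat_profile \<alpha> p))"
proof -
  have q: "0 \<le> 1 - 1 / real p" using p by simp
  obtain v where v: "0 < v" "\<And>u. 0 < u \<Longrightarrow> lattice_sum p \<alpha> v \<le> lattice_sum p \<alpha> u"
    using lattice_sum_attains_bounds(1) by blast
  have "(LEAST y. y \<in> range (heat_profile \<alpha> p)) = (1 - 1 / real p) * lattice_sum p \<alpha> v"
    unfolding range_heat_profile using v q by (intro Least_equality) (auto intro!: mult_left_mono)
  then show "0 < u \<Longrightarrow> (LEAST y. y \<in> range (heat_profile \<alpha> p)) \<le> (1 - 1 / real p) * lattice_sum p \<alpha> u"
    "(\<And>u. 0 < u \<Longrightarrow> c \<le> (1 - 1 / real p) * lattice_sum p \<alpha> u) \<Longrightarrow>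
      c \<le> (LEAST y. y \<in> range (heat_profile \<alpha> p))"
    using v q by (auto intro!: mult_left_mono)
qed

lemma Greatest_heat_profile:
  shows "0 < u \<Longrightarrow> (1 - 1 / real p) * lattice_sum p \<alpha> u \<le> (GREATEST y. y \<in> range (heat_profile \<alpha> p))"
    and "(\<And>u. 0 < u \<Longrightarrow> (1 - 1 / real p) * lattice_sum p \<alpha> u \<le> c) \<Longrightarrow>
      (GREATEST y. y \<in> range (heat_profile \<alpha> p)) \<le> c"
proof -
  have q: "0 \<le> 1 - 1 / real p" using p by simp
  obtain v where v: "0 < v" "\<And>u. 0 < u \<Longrightarrow> lattice_sum p \<alpha> u \<le> lattice_sum p \<alpha> v"
    using lattice_sum_attains_bounds(2) by blast
  have "(GREATEST y. y \<in> range (heat_profile \<alpha> p)) = (1 - 1 / real p) * lattice_sum p \<alpha> v"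
    unfolding range_heat_profile using v q by (intro Greatest_equality) (auto intro!: mult_left_mono)
  then show "0 < u \<Longrightarrow> (1 - 1 / real p) * lattice_sum p \<alpha> u \<le> (GREATEST y. y \<in> range (heat_profile \<alpha> p))"
    "(\<And>u. 0 < u \<Longrightarrow> (1 - 1 / real p) * lattice_sum p \<alpha> u \<le> c) \<Longrightarrow>
      (GREATEST y. y \<in> range (heat_profile \<alpha> p)) \<le> c"
    using v q by (auto intro!: mult_left_mono)
qed

text \<open>
  The fundamental domain \<open>[p\<^sup>-\<^sup>1\<^sup>/\<^sup>2, p\<^sup>1\<^sup>/\<^sup>2)\<close> keeps \<open>u\<close> far from the neighbouring terms on both
  sides: both \<open>u / p\<close> and \<open>1 / (u p)\<close> are at most \<open>p\<^sup>-\<^sup>1\<^sup>/\<^sup>2\<close> there.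
\<close>
lemma max_heat_profile_bounds:
  defines "h \<equiv> (exp 1 * \<alpha>) powr (- 1 / \<alpha>)" and "C \<equiv> damped_const \<alpha>"
  shows "(1 - 1 / real p) * h \<le> (GREATEST y. y \<in> range (heat_profile \<alpha> p))"
    and "(GREATEST y. y \<in> range (heat_profile \<alpha> p)) \<le>
      h + sqrt p / (real p - 1) + C / sqrt p + C / (sqrt p * (real p - 1))"
proof -
  have p1: "1 < real p" using p by simp
  have q: "0 \<le> 1 - 1 / real p" "1 - 1 / real p \<le> 1" using p1 by simp_all
  have C: "0 < C" unfolding C_def by (rule damped_const_pos[OF \<alpha>])
  have "h \<le> lattice_sum p \<alpha> (\<alpha> powr (- 1 / \<alpha>))"
    using lattice_sum_ge[OF p \<alpha>, of "\<alpha> powr (- 1 / \<alpha>)" 0] damped_at_max[OF \<alpha>] \<alpha> by (simp add: h_def)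
  then have "(1 - 1 / real p) * h \<le> (1 - 1 / real p) * lattice_sum p \<alpha> (\<alpha> powr (- 1 / \<alpha>))"
    using q by (intro mult_left_mono)
  also have "\<dots> \<le> (GREATEST y. y \<in> range (heat_profile \<alpha> p))"
    by (rule Greatest_heat_profile(1)) (use \<alpha> in simp)
  finally show "(1 - 1 / real p) * h \<le> (GREATEST y. y \<in> range (heat_profile \<alpha> p))" .
  show "(GREATEST y. y \<in> range (heat_profile \<alpha> p)) \<le>
      h + sqrt p / (real p - 1) + C / sqrt p + C / (sqrt p * (real p - 1))"
  proof (rule Greatest_heat_profile(2))
    fix u :: real assume "0 < u"
    have s: "0 < sqrt p" "1 / sqrt p * real p = sqrt p" using p1 by (simp_all add: field_simps)
    obtain j where j: "1 / sqrt p \<le> u * real p powi j" "u * real p powi j < 1 / sqrt p * real p"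
      using fundamental_domain[of "1 / sqrt p" u] s \<open>0 < u\<close> by auto
    define v where "v = u * real p powi j"
    have v: "0 < v" "v \<le> sqrt p" "sqrt p \<le> v * p"
      using j s p1 \<open>0 < u\<close> mult_right_mono[OF j(1), of "real p"] by (simp_all add: v_def)
    have "(1 - 1 / real p) * lattice_sum p \<alpha> u = (1 - 1 / real p) * lattice_sum p \<alpha> v"
      unfolding v_def by (simp add: lattice_sum_shift[OF p \<alpha>])
    also have "\<dots> \<le> 1 * lattice_sum p \<alpha> v"
      using q less_imp_le[OF lattice_sum_pos[OF p \<alpha> v(1)]] by (intro mult_right_mono)
    also have "\<dots> \<le> v / (real p - 1) + damped \<alpha> v + damped \<alpha> (v * p) + C / (v * p * (real p - 1))"
      using lattice_sum_bound(2)[OF p \<alpha> v(1)] by (simp add: C_def)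
    also have "\<dots> \<le> sqrt p / (real p - 1) + h + C / sqrt p + C / (sqrt p * (real p - 1))"
    proof (intro add_mono)
      show "v / (real p - 1) \<le> sqrt p / (real p - 1)" using v p1 by (intro divide_right_mono) auto
      show "damped \<alpha> v \<le> h" unfolding h_def by (rule damped_le_max[OF \<alpha> v(1)])
      have "damped \<alpha> (v * p) \<le> C / (v * p)"
        unfolding C_def using v p1 by (intro damped_le_inverse \<alpha>) auto
      also have "\<dots> \<le> C / sqrt p" using v s C by (intro divide_left_mono) auto
      finally show "damped \<alpha> (v * p) \<le> C / sqrt p" .
      show "C / (v * p * (real p - 1)) \<le> C / (sqrt p * (real p - 1))"
        using v s C p1 by (intro divide_left_mono mult_right_mono mult_pos_pos) auto
    qed
    finally show "(1 - 1 / real p) * lattice_sum p \<alpha> u \<le>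
        h + sqrt p / (real p - 1) + C / sqrt p + C / (sqrt p * (real p - 1))" by simp
  qed
qed

text \<open>
  Evaluate at \<open>u = (1 + \<delta>) (ln p)\<^sup>1\<^sup>/\<^sup>\<alpha> / p\<close>. The factor \<open>1 + \<delta>\<close> makes
  \<open>exp (- (p u)\<^sup>\<alpha>)\<close> smaller than \<open>1 / p\<close> by a power of \<open>p\<close>, so that the term at \<open>p u\<close> is negligible
  against the term at \<open>u\<close>.
\<close>
lemma min_heat_profile_upper:
  assumes \<delta>: "0 < \<delta>"
  shows "(LEAST y. y \<in> range (heat_profile \<alpha> p)) / (ln (real p) powr (1 / \<alpha>) / real p) \<le>
    (1 + \<delta>) * (1 / (real p - 1) + 1) + (1 + \<delta>) * (real p * real p powr (- ((1 + \<delta>) powr \<alpha>))) +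
    damped_const \<alpha> / (1 + \<delta>) * (real p / ((real p - 1) * (ln (real p) powr (1 / \<alpha>) * ln (real p) powr (1 / \<alpha>))))"
proof -
  have p1: "1 < real p" using p by simp
  have q: "0 \<le> 1 - 1 / real p" "1 - 1 / real p \<le> 1" using p1 by simp_all
  define L where "L = ln (real p) powr (1 / \<alpha>)"
  have L: "0 < L" unfolding L_def using p1 by simp
  define u where "u = (1 + \<delta>) * L / real p"
  have u: "0 < u" unfolding u_def using L \<delta> p1 by simp
  have up: "u * p = (1 + \<delta>) * L" using p1 by (simp add: u_def)
  have "(u * p) powr \<alpha> = (1 + \<delta>) powr \<alpha> * ln (real p)"
    unfolding up using \<delta> L p1 \<alpha> by (simp add: powr_mult L_def powr_powr)
  then have d: "damped \<alpha> (u * p) = (1 + \<delta>) * L * real p powr (- ((1 + \<delta>) powr \<alpha>))"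
    unfolding damped_def up[symmetric] using p1 by (simp add: powr_def mult.commute)
  have "(LEAST y. y \<in> range (heat_profile \<alpha> p)) \<le> (1 - 1 / real p) * lattice_sum p \<alpha> u"
    by (rule Least_heat_profile(1)[OF u])
  also have "\<dots> \<le> 1 * lattice_sum p \<alpha> u"
    using q less_imp_le[OF lattice_sum_pos[OF p \<alpha> u]] by (intro mult_right_mono)
  also have "\<dots> \<le> u / (real p - 1) + u + damped \<alpha> (u * p) + damped_const \<alpha> / (u * p * (real p - 1))"
    using lattice_sum_bound(2)[OF p \<alpha> u] damped_le_self[OF u, of \<alpha>] by simp
  finally have "(LEAST y. y \<in> range (heat_profile \<alpha> p)) / (L / real p) \<le>
    (u / (real p - 1) + u + damped \<alpha> (u * p) + damped_const \<alpha> / (u * p * (real p - 1))) / (L / real p)"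
    using L p1 by (intro divide_right_mono) auto
  also have "\<dots> = (1 + \<delta>) * (1 / (real p - 1) + 1) + (1 + \<delta>) * (real p * real p powr (- ((1 + \<delta>) powr \<alpha>))) +
    damped_const \<alpha> / (1 + \<delta>) * (real p / ((real p - 1) * (L * L)))"
  proof -
    have e1: "u / (real p - 1) / (L / real p) = (1 + \<delta>) * (1 / (real p - 1))"
      "u / (L / real p) = 1 + \<delta>"
      using L p1 by (simp_all add: u_def)
    have e2: "(1 + \<delta>) * L * X / (L / real p) = (1 + \<delta>) * (real p * X)" for X
      using L p1 by simp
    have e3: "C / ((1 + \<delta>) * L * (real p - 1)) / (L / real p) = C / (1 + \<delta>) * (real p / ((real p - 1) * (L * L)))" for C
      by (simp add: mult_ac)
    show ?thesis
      unfolding d unfolding up add_divide_distrib[of _ _ "L / real p"] e1 e2 e3 by (simp add: distrib_left)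
  qed
  finally show ?thesis unfolding L_def .
qed

text \<open>
  Every \<open>u\<close> can be moved into the period \<open>[a, a p)\<close> with \<open>a = (1 - \<delta>) (ln p)\<^sup>1\<^sup>/\<^sup>\<alpha> / p\<close>, and
  there a single term is large enough. Below \<open>1 / ln p\<close> the exponential factor is nearly 1, so the
  term is at least about \<open>a\<close>; above, the term is at least \<open>1 / ln p\<close> times \<open>p\<close> to the power
  \<open>- (1 - \<delta>)\<^sup>\<alpha>\<close>, which the assumption \<open>large\<close> compares with \<open>a\<close>.
\<close>
lemma min_heat_profile_lower:
  assumes \<delta>: "0 < \<delta>" "\<delta> < 1"
    and large: "1 \<le> real p powr (1 - (1 - \<delta>) powr \<alpha>) / (ln (real p) powr (1 / \<alpha>) * ln (real p))"
  shows "(1 - 1 / real p) * ((1 - \<delta>) * exp (- ((1 / ln (real p)) powr \<alpha>))) \<le>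
    (LEAST y. y \<in> range (heat_profile \<alpha> p)) / (ln (real p) powr (1 / \<alpha>) / real p)"
proof -
  have p1: "1 < real p" using p by simp
  have q: "0 \<le> 1 - 1 / real p" using p1 by simp
  define l where "l = ln (real p)"
  have l: "0 < l" unfolding l_def using p1 by simp
  define L where "L = l powr (1 / \<alpha>)"
  have L: "0 < L" unfolding L_def using l by simp
  define a where "a = (1 - \<delta>) * L / real p"
  define c where "c = a * exp (- ((1 / l) powr \<alpha>))"
  have a: "0 < a" unfolding a_def using \<delta> L p1 by simp
  have "c \<le> lattice_sum p \<alpha> u" if "0 < u" for u
  proof -
    obtain j where j: "a \<le> u * real p powi j" "u * real p powi j < a * real p"
      using fundamental_domain[OF a \<open>0 < u\<close>] by blast
    define v where "v = u * real p powi j"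
    have v: "a \<le> v" "v \<le> (1 - \<delta>) * L" "0 < v" using j a p1 by (simp_all add: v_def a_def)
    have "c \<le> damped \<alpha> v"
    proof (cases "v \<le> 1 / l")
      case True
      then have "v powr \<alpha> \<le> (1 / l) powr \<alpha>" using v \<alpha> by (intro powr_mono2) auto
      then show ?thesis unfolding c_def damped_def using v a by (intro mult_mono) auto
    next
      case False
      have "v powr \<alpha> \<le> ((1 - \<delta>) * L) powr \<alpha>" using v \<alpha> by (intro powr_mono2) auto
      also have "\<dots> = (1 - \<delta>) powr \<alpha> * l" using \<delta> l \<alpha> by (simp add: powr_mult L_def powr_powr)
      finally have *: "real p powr (- ((1 - \<delta>) powr \<alpha>)) \<le> exp (- (v powr \<alpha>))"
        using p1 by (simp add: powr_def l_def)
      have "c \<le> a" unfolding c_def using a by (simp add: mult_left_le)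
      also have "\<dots> \<le> 1 * L / real p" unfolding a_def using \<delta> L p1 by (intro divide_right_mono mult_right_mono) auto
      also have "\<dots> \<le> 1 / l * real p powr (- ((1 - \<delta>) powr \<alpha>))"
      proof -
        have "L * l \<le> real p powr (1 - (1 - \<delta>) powr \<alpha>)"
          using large L l by (simp add: l_def[symmetric] L_def[symmetric] field_simps)
        also have "\<dots> = real p * real p powr (- ((1 - \<delta>) powr \<alpha>))"
          using p1 powr_add[of "real p" 1 "- ((1 - \<delta>) powr \<alpha>)"] by simp
        finally show ?thesis using l p1 by (simp add: field_simps)
      qed
      also have "\<dots> \<le> v * exp (- (v powr \<alpha>))"
        using False * v l by (intro mult_mono) auto
      finally show ?thesis by (simp add: damped_def)
    qed
    also have "\<dots> \<le> lattice_sum p \<alpha> u" unfolding v_def by (rule lattice_sum_ge[OF p \<alpha> \<open>0 < u\<close>])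
    finally show ?thesis .
  qed
  then have "(1 - 1 / real p) * c \<le> (LEAST y. y \<in> range (heat_profile \<alpha> p))"
    using q by (intro Least_heat_profile(2) mult_left_mono) auto
  then have "(1 - 1 / real p) * c / (L / real p) \<le> (LEAST y. y \<in> range (heat_profile \<alpha> p)) / (L / real p)"
    using L p1 by (intro divide_right_mono) auto
  also have "(1 - 1 / real p) * c / (L / real p) = (1 - 1 / real p) * ((1 - \<delta>) * exp (- ((1 / l) powr \<alpha>)))"
    unfolding c_def a_def using L p1 by simp
  finally show ?thesis by (simp add: L_def l_def)
qed

end

lemma max_heat_profile_limit:
  assumes \<alpha>: "0 < \<alpha>"
  shows "(\<lambda>p. GREATEST y. y \<in> range (heat_profile \<alpha> p)) \<longlonglongrightarrow> (exp 1 * \<alpha>) powr (- 1 / \<alpha>)"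
proof (rule tendsto_sandwich)
  define h C where "h = (exp 1 * \<alpha>) powr (- 1 / \<alpha>)" and "C = damped_const \<alpha>"
  show "\<forall>\<^sub>F p in sequentially. (1 - 1 / real p) * h \<le> (GREATEST y. y \<in> range (heat_profile \<alpha> p))"
    using eventually_ge_at_top[of 2] unfolding h_def
    by eventually_elim (rule max_heat_profile_bounds(1)[OF _ \<alpha>])
  show "\<forall>\<^sub>F p in sequentially. (GREATEST y. y \<in> range (heat_profile \<alpha> p)) \<le>
      h + sqrt p / (real p - 1) + C / sqrt p + C / (sqrt p * (real p - 1))"
    using eventually_ge_at_top[of 2] unfolding h_def C_def
    by eventually_elim (rule max_heat_profile_bounds(2)[OF _ \<alpha>])
  show "(\<lambda>p. (1 - 1 / real p) * h) \<longlonglongrightarrow> (exp 1 * \<alpha>) powr (- 1 / \<alpha>)"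
    unfolding h_def[symmetric] by real_asymp
  show "(\<lambda>p. h + sqrt (real p) / (real p - 1) + C / sqrt (real p) + C / (sqrt (real p) * (real p - 1)))
      \<longlonglongrightarrow> (exp 1 * \<alpha>) powr (- 1 / \<alpha>)"
    unfolding h_def[symmetric] by real_asymp
qed

lemma min_heat_profile_asymp:
  assumes \<alpha>: "0 < \<alpha>"
  shows "(\<lambda>p. LEAST y. y \<in> range (heat_profile \<alpha> p)) \<sim>[sequentially] (\<lambda>p. ln (real p) powr (1 / \<alpha>) / real p)"
proof (rule asymp_equivI', rule tendstoI)
  fix \<epsilon> :: real assume \<epsilon>: "0 < \<epsilon>"
  define \<delta> where "\<delta> = min (\<epsilon> / 2) (1 / 2)"
  have \<delta>: "0 < \<delta>" "\<delta> < 1" "\<delta> < \<epsilon>" using \<epsilon> by (auto simp: \<delta>_def)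
  define \<gamma> C where "\<gamma> = 1 / \<alpha>" and "C = damped_const \<alpha> / (1 + \<delta>)"
  have \<gamma>: "0 < \<gamma>" using \<alpha> by (simp add: \<gamma>_def)
  define \<kappa> where "\<kappa> = (1 + \<delta>) powr \<alpha> - 1"
  have \<kappa>: "0 < \<kappa>" unfolding \<kappa>_def using \<delta> \<alpha> by simp
  define \<mu> where "\<mu> = 1 - (1 - \<delta>) powr \<alpha>"
  have \<mu>: "0 < \<mu>" unfolding \<mu>_def using \<delta> \<alpha> powr_less_mono2[of \<alpha> "1 - \<delta>" 1] by simp
  have "(\<lambda>p. (1 + \<delta>) * (1 / (real p - 1) + 1) + (1 + \<delta>) * (real p * real p powr (- (\<kappa> + 1))) +
      C * (real p / ((real p - 1) * (ln (real p) powr \<gamma> * ln (real p) powr \<gamma>)))) \<longlonglongrightarrow> 1 + \<delta>"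
    using \<kappa> \<gamma> by real_asymp
  then have upper: "\<forall>\<^sub>F p in sequentially. (1 + \<delta>) * (1 / (real p - 1) + 1) +
      (1 + \<delta>) * (real p * real p powr (- (\<kappa> + 1))) +
      C * (real p / ((real p - 1) * (ln (real p) powr \<gamma> * ln (real p) powr \<gamma>))) < 1 + \<epsilon>"
    by (rule order_tendstoD(2)) (use \<delta> in simp)
  have "(\<lambda>p. (1 - 1 / real p) * ((1 - \<delta>) * exp (- ((1 / ln (real p)) powr \<alpha>)))) \<longlonglongrightarrow> 1 - \<delta>"
    using \<alpha> by real_asymp
  then have lower: "\<forall>\<^sub>F p in sequentially. 1 - \<epsilon> < (1 - 1 / real p) * ((1 - \<delta>) * exp (- ((1 / ln (real p)) powr \<alpha>)))"
    by (rule order_tendstoD(1)) (use \<delta> in simp)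
  have "filterlim (\<lambda>p. real p powr \<mu> / (ln (real p) powr \<gamma> * ln (real p))) at_top sequentially"
    using \<mu> \<gamma> by real_asymp
  then have large: "\<forall>\<^sub>F p in sequentially. 1 \<le> real p powr \<mu> / (ln (real p) powr \<gamma> * ln (real p))"
    by (simp add: filterlim_at_top)
  show "\<forall>\<^sub>F p in sequentially. dist ((LEAST y. y \<in> range (heat_profile \<alpha> p)) /
      (ln (real p) powr (1 / \<alpha>) / real p)) 1 < \<epsilon>"
    using upper lower large eventually_ge_at_top[of 2]
  proof eventually_elim
    case (elim p)
    define x where "x = (LEAST y. y \<in> range (heat_profile \<alpha> p)) / (ln (real p) powr (1 / \<alpha>) / real p)"
    have "x < 1 + \<epsilon>"
      using min_heat_profile_upper[OF elim(4) \<alpha> \<delta>(1)] elim(1)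
      unfolding x_def C_def \<gamma>_def \<kappa>_def by simp
    moreover have "1 - \<epsilon> < x"
      using min_heat_profile_lower[OF elim(4) \<alpha> \<delta>(1,2)] elim(2,3)
      unfolding x_def \<gamma>_def \<mu>_def by simp
    ultimately show ?case unfolding x_def[symmetric] by (simp add: dist_real_def abs_less_iff)
  qed
qed

section \<open>Heat kernels for power eigenvalues\<close>

lemma has_sum_int_intervals:
  fixes f :: "int \<Rightarrow> real"
  assumes "(f has_sum S) UNIV"
  shows "(\<lambda>n. sum f {- int n..<2 * int n}) \<longlonglongrightarrow> S"
proof -
  have "filterlim (\<lambda>n. {- int n..<2 * int n}) (finite_subsets_at_top UNIV) sequentially"
    unfolding filterlim_finite_subsets_at_top
  proof (intro allI impI)
    fix X :: "int set" assume X: "finite X \<and> X \<subseteq> UNIV"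
    have bound: "\<bar>x\<bar> \<le> (\<Sum>y\<in>X. \<bar>y\<bar>)" if "x \<in> X" for x
      using X that by (intro member_le_sum) auto
    define N where "N = Suc (nat (\<Sum>y\<in>X. \<bar>y\<bar>))"
    have "X \<subseteq> {- int n..<2 * int n}" if "N \<le> n" for n
    proof
      fix x assume "x \<in> X"
      then show "x \<in> {- int n..<2 * int n}" using bound[of x] that by (simp add: N_def) linarith
    qed
    then show "\<forall>\<^sub>F n in sequentially. finite {- int n..<2 * int n} \<and> X \<subseteq> {- int n..<2 * int n} \<and>
        {- int n..<2 * int n} \<subseteq> UNIV"
      by (intro eventually_sequentiallyI[of N]) auto
  qed
  then show ?thesis using assms unfolding has_sum_def by (rule filterlim_compose[rotated])
qed

text \<open>
  With \<open>u = t\<^sup>1\<^sup>/\<^sup>\<alpha> c\<close>, the summand of index \<open>i\<close> is \<open>(p - 1) / u\<close> times the term of the lattice sum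
  at \<open>u p\<^sup>-\<^sup>i\<^sup>-\<^sup>1\<close>, because \<open>t \<lambda>\<^sub>i\<^sub>+\<^sub>1\<close> is the power \<open>\<alpha>\<close> of \<open>u p\<^sup>-\<^sup>i\<^sup>-\<^sup>1\<close>.
\<close>
lemma heat_kernel_diag_power_eigenvalues:
  assumes p: "2 \<le> p" and \<alpha>: "0 < \<alpha>" and M: "haar_measure p M" and c: "0 < c"
    and K: "heat_kernel p M (power_eigenvalues p c \<alpha>) K" and t: "0 < t" and x: "x \<in> Qp p"
  shows "K t x x = t powr (- 1 / \<alpha>) * (real p / c) *
    heat_profile \<alpha> p (log (real p) t + \<alpha> * log (real p) (c / real p))"
proof -
  have p1: "1 < real p" using p by simp
  define lam where "lam = power_eigenvalues p c \<alpha>"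
  have lam: "lam i = (c / real p powi i) powr \<alpha>" for i by (simp add: lam_def power_eigenvalues_def)
  have nonneg: "0 \<le> lam i" for i by (simp add: lam)
  have decr: "lam (i + 1) \<le> lam i" for i
    unfolding lam using c p1 \<alpha> by (intro powr_mono2 divide_left_mono power_int_increasing) auto
  have lim: "(\<lambda>n. lam (k + int n)) \<longlonglongrightarrow> 0" for k
  proof -
    have "lam (k + int n) = lam k * ((1 / real p) powr \<alpha>) ^ n" for n
    proof -
      have "c / real p powi (k + int n) = (c / real p powi k) * (1 / real p) ^ n"
        using p1 by (simp add: power_int_add power_one_over)
      then have "lam (k + int n) = (c / real p powi k) powr \<alpha> * ((1 / real p) ^ n) powr \<alpha>"
        unfolding lam using c p1 by (simp only: powr_mult)
      also have "((1 / real p) ^ n) powr \<alpha> = ((1 / real p) powr \<alpha>) ^ n"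
        using p1 by (simp add: powr_realpow[symmetric] powr_powr mult.commute)
      finally show ?thesis by (simp add: lam)
    qed
    moreover have "(1 / real p) powr \<alpha> < 1"
      using powr_less_mono2[OF \<alpha>, of "1 / real p" 1] p1 by simp
    then have "(\<lambda>n. lam k * ((1 / real p) powr \<alpha>) ^ n) \<longlonglongrightarrow> lam k * 0"
      by (intro tendsto_intros LIMSEQ_realpow_zero) auto
    ultimately show ?thesis by simp
  qed
  define u where "u = t powr (1 / \<alpha>) * c"
  have u: "0 < u" using t c by (simp add: u_def)
  define f where "f i = exp (- lam (i + 1) * t) * (real p powi (- i) - real p powi (- (i + 1)))" for i
  have f: "f i = (real p - 1) / u * damped \<alpha> (u * real p powi (- (i + 1)))" for i
  proof -
    define P where "P = real p powi (- (i + 1))"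
    have "real p powi (1 + - (i + 1)) = real p powi 1 * P"
      unfolding P_def using p1 by (intro power_int_add) simp
    moreover have "P = inverse (real p powi (i + 1))" unfolding P_def by (rule power_int_minus)
    ultimately have P: "0 < P" "real p powi (- i) = real p * P" "c / real p powi (i + 1) = c * P"
      using p1 by (simp_all add: divide_inverse)
    have "(u * P) powr \<alpha> = t * (c * P) powr \<alpha>"
      unfolding u_def using t c P \<alpha> by (simp add: powr_mult powr_powr)
    then have "(u * P) powr \<alpha> = lam (i + 1) * t" by (simp add: lam P(3))
    then show ?thesis
      unfolding f_def damped_def P_def[symmetric] P(2) using u by (simp add: field_simps)
  qed
  have "((\<lambda>j. (real p - 1) / u * damped \<alpha> (u * real p powi j)) has_sum ((real p - 1) / u * lattice_sum p \<alpha> u)) UNIV"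
    unfolding lattice_sum_def
    by (intro has_sum_cmult_right has_sum_infsum lattice_sum_bound(1)[OF p \<alpha> u])
  also have "?this \<longleftrightarrow> (f has_sum ((real p - 1) / u * lattice_sum p \<alpha> u)) UNIV"
    by (rule has_sum_reindex_bij_witness[of _ "\<lambda>i. - (i + 1)" "\<lambda>j. - (j + 1)"]) (auto simp: f)
  finally have "(\<lambda>n. sum f {- int n..<2 * int n}) \<longlonglongrightarrow> (real p - 1) / u * lattice_sum p \<alpha> u"
    by (rule has_sum_int_intervals)
  moreover have "(\<lambda>n. sum f {- int n..<2 * int n}) \<longlonglongrightarrow> K t x x"
    unfolding f_def using K by (intro heat_kernel_diag_limit[OF p M _ x t nonneg decr lim]) (simp add: lam_def)
  ultimately have "K t x x = (real p - 1) / u * lattice_sum p \<alpha> u"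
    by (rule LIMSEQ_unique[rotated])
  also have "lattice_sum p \<alpha> u = lattice_sum p \<alpha> (u * real p powi (- 1))"
    by (rule lattice_sum_shift[OF p \<alpha>, symmetric])
  also have "u * real p powi (- 1) = real p powr ((log (real p) t + \<alpha> * log (real p) (c / real p)) / \<alpha>)"
  proof -
    have "(log (real p) t + \<alpha> * log (real p) (c / real p)) / \<alpha> = log (real p) t * (1 / \<alpha>) + log (real p) (c / real p)"
      using \<alpha> by (simp add: field_simps)
    then have "real p powr ((log (real p) t + \<alpha> * log (real p) (c / real p)) / \<alpha>) =
        (real p powr log (real p) t) powr (1 / \<alpha>) * real p powr log (real p) (c / real p)"
      by (simp only: powr_add powr_powr)
    also have "\<dots> = t powr (1 / \<alpha>) * (c / real p)"
      using p1 t c by simp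
    finally show ?thesis using p1 by (simp add: u_def power_int_minus field_simps)
  qed
  also have "(real p - 1) / u = t powr (- 1 / \<alpha>) * (real p / c) * (1 - 1 / real p)"
    using p1 c t by (simp add: u_def powr_minus field_simps)
  finally show ?thesis by (simp add: heat_profile_def)
qed

lemma heat_profile_props:
  assumes p: "2 \<le> p" and \<alpha>: "0 < \<alpha>"
  shows "\<not> heat_profile \<alpha> p constant_on UNIV" and "0 < heat_profile \<alpha> p s"
    and "continuous_on UNIV (heat_profile \<alpha> p)" and "heat_profile \<alpha> p (s + \<alpha>) = heat_profile \<alpha> p s"
proof -
  have p1: "1 < real p" using p by simp
  show "0 < heat_profile \<alpha> p s"
    unfolding heat_profile_def using p1 by (intro mult_pos_pos lattice_sum_pos[OF p \<alpha>]) auto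
  show "continuous_on UNIV (heat_profile \<alpha> p)"
    unfolding heat_profile_def using p1 \<alpha>
    by (intro continuous_intros continuous_on_compose2[OF continuous_on_lattice_sum[OF p \<alpha>]]) auto
  show "heat_profile \<alpha> p (s + \<alpha>) = heat_profile \<alpha> p s"
    using lattice_sum_shift[OF p \<alpha>, of "real p powr (s / \<alpha>)" 1] p1 \<alpha>
    by (simp add: heat_profile_def add_divide_distrib powr_add)
  show "\<not> heat_profile \<alpha> p constant_on UNIV"
  proof
    assume "heat_profile \<alpha> p constant_on UNIV"
    then obtain c where c: "\<And>s. heat_profile \<alpha> p s = c" by (auto simp: constant_on_def)
    have "lattice_sum p \<alpha> u = c / (1 - 1 / real p)" if "0 < u" for u
      using c[of "\<alpha> * log (real p) u"] that p1 \<alpha> by (simp add: heat_profile_def field_simps)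
    then show False by (rule lattice_sum_not_constant[OF p \<alpha>])
  qed
qed

theorem theorem3p2:
  fixes \<alpha> :: real and m :: "nat \<Rightarrow> (int \<Rightarrow> nat) measure"
  assumes "0 < \<alpha>"
    and "\<And>p. 2 \<le> p \<Longrightarrow> haar_measure p (m p)"
  shows "\<exists>A :: nat \<Rightarrow> real \<Rightarrow> real.
    (\<forall>p\<ge>2.
       \<not> (A p) constant_on UNIV \<and>
       (\<forall>s. 0 < A p s) \<and>
       continuous_on UNIV (A p) \<and>
       (\<forall>s. A p (s + \<alpha>) = A p s) \<and>
       (\<forall>K. heat_kernel p (m p) (fractional_eigenvalues p \<alpha>) K \<longrightarrow>
          (\<forall>t>0. \<forall>x\<in>Qp p. K t x x = t powr (- 1 / \<alpha>) * A p (log (real p) t))) \<and>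
       (\<forall>c>0. \<forall>K. heat_kernel p (m p) (power_eigenvalues p c \<alpha>) K \<longrightarrow>
          (\<forall>t>0. \<forall>x\<in>Qp p. K t x x =
             t powr (- 1 / \<alpha>) * (real p / c) * A p (log (real p) t + \<alpha> * log (real p) (c / real p))))) \<and>
    (\<lambda>p. LEAST y. y \<in> range (A p)) \<sim>[sequentially] (\<lambda>p. ln (real p) powr (1 / \<alpha>) / real p) \<and>
    (\<lambda>p. GREATEST y. y \<in> range (A p)) \<longlonglongrightarrow> (exp 1 * \<alpha>) powr (- 1 / \<alpha>)"
proof (intro exI[of _ "heat_profile \<alpha>"] conjI allI impI ballI)
  note \<alpha> = assms(1)
  show "(\<lambda>p. LEAST y. y \<in> range (heat_profile \<alpha> p)) \<sim>[sequentially] (\<lambda>p. ln (real p) powr (1 / \<alpha>) / real p)"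
    by (rule min_heat_profile_asymp[OF \<alpha>])
  show "(\<lambda>p. GREATEST y. y \<in> range (heat_profile \<alpha> p)) \<longlonglongrightarrow> (exp 1 * \<alpha>) powr (- 1 / \<alpha>)"
    by (rule max_heat_profile_limit[OF \<alpha>])
  fix p :: nat assume p: "2 \<le> p"
  note M = assms(2)[OF p]
  show "\<not> heat_profile \<alpha> p constant_on UNIV" "continuous_on UNIV (heat_profile \<alpha> p)"
    by (rule heat_profile_props[OF p \<alpha>])+
  show "0 < heat_profile \<alpha> p s" "heat_profile \<alpha> p (s + \<alpha>) = heat_profile \<alpha> p s" for s
    by (rule heat_profile_props[OF p \<alpha>])+
  fix K t x assume t: "(0::real) < t" and x: "x \<in> Qp p"
  show "K t x x = t powr (- 1 / \<alpha>) * (real p / c) *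
      heat_profile \<alpha> p (log (real p) t + \<alpha> * log (real p) (c / real p))"
    if "0 < c" "heat_kernel p (m p) (power_eigenvalues p c \<alpha>) K" for c
    by (rule heat_kernel_diag_power_eigenvalues[OF p \<alpha> M that t x])
  show "K t x x = t powr (- 1 / \<alpha>) * heat_profile \<alpha> p (log (real p) t)"
    if "heat_kernel p (m p) (fractional_eigenvalues p \<alpha>) K"
    using heat_kernel_diag_power_eigenvalues[OF p \<alpha> M _ that t x] p by simp
qed

end
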